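(* Let $C^{(\sigma)}=(c^{(\sigma)}_1,\dots,c^{(\sigma)}_{L-1})\in\mathbb C^{L-1}$, $\sigma=1,\dots,L-2$, be any ($a$-independent) basis of the space of solutions of $\sum_{k=1}^{L-1}c_k=0$. For $a\in\mathfrak h^*$ with $K_{k,a}\ne0$ for all $1\le k\le L-1$, put $$h^{(\sigma)}_{1,a}=-\sum_{i=1}^{L-1}\alpha_ic_{-1}\sum_{k=1}^{L-1}\frac{c^{(\sigma)}_k}{[k]K_{k,a}}\sum_{m=1}^k\omega^{m-i-\frac{k+1}2}\sum_{\substack{1\le s_1<\dots<s_k\le L\\ s_m>i}}\omega^{\langle a,H_{s_1}+\dots+H_{s_k}\rangle},\qquad\sigma=1,\dots,L-2,$$ and $$h^{(L-1)}_{1,a}=\iota_1=\sum_{i=1}^{L-1}\omega^{\frac{L-i}2}[i]\,\alpha_ic_{-1}.$$ Then for $\sigma=1,\dots,L-1$ and all $w\in\mathcal W$ $$J^{h^{(\sigma)}_{1,a}}_{N,a}(x_1,\dots,x_N)_{k_1\dots k_N}=J^{h^{(\sigma)}_{1,wa}}_{N,wa}(x_1,\dots,x_N)_{k_1\dots k_N}$$ for all $N\ge0$ and all $k_1,\dots,k_N\in\{1,\dots,L-1\}$.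
   Context: Fix an integer $L\ge2$ and an irrational $p\in(0,1)$; $\omega=e^{2\pi i/L}$, $\omega^c:=e^{2\pi i c/L}$ for $c\in\mathbb C$, and $[k]=\sin\frac{\pi k}L/\sin\frac\pi L$. $\mathfrak h^*$ is the complex dual Cartan subalgebra of the Lie algebra $A_{L-1}$ with its invariant bilinear form $\langle\cdot,\cdot\rangle$ and simple roots $\alpha_1,\dots,\alpha_{L-1}$, $\langle\alpha_i,\alpha_j\rangle=2\delta_{ij}-\delta_{i,j+1}-\delta_{i,j-1}$. $H_1,\dots,H_L\in\mathfrak h^*$ are the weights of the first fundamental representation: $\langle\alpha_i,H_s\rangle=\delta_{is}-\delta_{i,s-1}$, $\sum_sH_s=0$. For $S\subseteq\{1,\dots,L\}$ put $H_S=\sum_{s\in S}H_s$. The Weyl group $\mathcal W$ is generated by $w_ia=a-\langle a,\alpha_i\rangle\alpha_i$, $i=1,\dots,L-1$. Let $$f(z)=\frac{(z-\omega^p)(z-\omega^{1-p})}{(z-1)(z-\omega)},\qquad K_{k,a}=\sum_{S\subseteq\{1,\dots,L\},\,|S|=k}\omega^{\langle a,H_S\rangle}.$$ **Algebra.** $\mathcal A$ is the free commutative (polynomial) $\mathbb C$-algebra on generators $\alpha_ic_{-n}$, $1\le i\le L-1$, $n\ge1$ (in "$\alpha_ic_{-1}$" the symbol is a single generator, not to be confused with the numbers $c^{(\sigma)}_k$). **Rational functions $J^h_{N,a}$, $h\in\mathcal A$.** Let $N\ge0$, $k_1,\dots,k_N\in\{1,\dots,L-1\}$. For a tuple $\underline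 S=(S_1,\dots,S_N)$ of subsets of $\{1,\dots,L\}$ with $|S_n|=k_n$, $S_n=\{s^{(n)}_1<\dots<s^{(n)}_{k_n}\}$, put $y^{(n)}_j=x_n\omega^{(k_n+1-2j)/2}$. Define the algebra homomorphism $E_{\underline S}:\mathcal A\to\mathbb C[x_1,\dots,x_N]$ by $$E_{\underline S}(\alpha_ic_{-m})=\sum_{n=1}^N\sum_{j=1}^{k_n}\langle\alpha_i,H_{s^{(n)}_j}\rangle\,\omega^{-\frac{L+1-2s^{(n)}_j}2m}(y^{(n)}_j)^m.$$ Let $\Phi_{\underline S}(x_1,\dots,x_N)$ be the product, over all $m<n$ and all pairs $(j,j')$ with $s^{(m)}_j\ne s^{(n)}_{j'}$, of the factors $f(y^{(m)}_j/y^{(n)}_{j'})$ if $s^{(m)}_j<s^{(n)}_{j'}$ and $f(y^{(n)}_{j'}/y^{(m)}_j)$ if $s^{(m)}_j>s^{(n)}_{j'}$. Then $$J^h_{N,a}(x_1,\dots,x_N)_{k_1\dots k_N}=\sum_{\underline S}\omega^{\langle a,\sum_nH_{S_n}\rangle}\,\Phi_{\underline S}\,E_{\underline S}(h).$$ *)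

theory Defs
  imports
    "HOL-Analysis.Analysis"
    "HOL-Library.Poly_Mapping"
    "HOL-Computational_Algebra.Polynomial_Factorial"
    "HOL-Algebra.Bij"
    "HOL-Algebra.Generated_Groups"
begin

definition om :: "nat \<Rightarrow> complex \<Rightarrow> complex" where
  "om L c = exp (2 * of_real pi * \<i> * c / of_nat L)"

definition qnum :: "nat \<Rightarrow> nat \<Rightarrow> complex" where
  "qnum L k = of_real (sin (pi * real k / real L) / sin (pi / real L))"


subsection \<open>The dual Cartan subalgebra, roots, weights and the Weyl group\<close>

text \<open>
  The dual Cartan subalgebra of \<open>A\<^bsub>L-1\<^esub>\<close> (traceless diagonal matrices) is realised, via the
  invariant form, as the space of vectors \<open>(a\<^sub>1, \<dots>, a\<^sub>L)\<close> with vanishing sum. Vectors indexed by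
  \<open>{1..L}\<close> are functions on \<^typ>\<open>nat\<close> that vanish outside \<open>{1..L}\<close>.
\<close>

definition hdual :: "nat \<Rightarrow> (nat \<Rightarrow> complex) set" where
  "hdual L = {a. (\<forall>s. s \<notin> {1..L} \<longrightarrow> a s = 0) \<and> (\<Sum>s=1..L. a s) = 0}"

definition pair :: "nat \<Rightarrow> (nat \<Rightarrow> complex) \<Rightarrow> (nat \<Rightarrow> complex) \<Rightarrow> complex" where
  "pair L a b = (\<Sum>s=1..L. a s * b s)"

definition sroot :: "nat \<Rightarrow> nat \<Rightarrow> complex" where
  "sroot i = (\<lambda>t. if t = i then 1 else if t = Suc i then -1 else 0)"

definition Hw :: "nat \<Rightarrow> nat \<Rightarrow> nat \<Rightarrow> complex" where
  "Hw L s = (\<lambda>t. if t \<in> {1..L} then (if t = s then 1 else 0) - 1 / of_nat L else 0)"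

definition HS :: "nat \<Rightarrow> nat set \<Rightarrow> nat \<Rightarrow> complex" where
  "HS L S = (\<lambda>t. \<Sum>s\<in>S. Hw L s t)"

definition wrefl :: "nat \<Rightarrow> nat \<Rightarrow> (nat \<Rightarrow> complex) \<Rightarrow> (nat \<Rightarrow> complex)" where
  "wrefl L i = (\<lambda>a\<in>hdual L. \<lambda>t. a t - pair L a (sroot i) * sroot i t)"

definition weyl :: "nat \<Rightarrow> ((nat \<Rightarrow> complex) \<Rightarrow> (nat \<Rightarrow> complex)) set" where
  "weyl L = generate (BijGroup (hdual L)) (wrefl L ` {1..L-1})"

lemma sroot_in_hdual: "i \<in> {1..L-1} \<Longrightarrow> sroot i \<in> hdual L"
proof -
  assume i: "i \<in> {1..L-1}"
  have "sroot i t = (if t = i then 1 else 0) + (if t = Suc i then -1 else 0)" for t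
    by (auto simp: sroot_def)
  then have "(\<Sum>t=1..L. sroot i t) = 0"
    using i by (simp add: sum.distrib) auto
  then show ?thesis
    using i by (auto simp: hdual_def sroot_def)
qed

lemma Hw_in_hdual: "s \<in> {1..L} \<Longrightarrow> Hw L s \<in> hdual L"
  by (auto simp: hdual_def Hw_def sum_subtractf)

lemma pair_sroot:
  assumes "i \<in> {1..L-1}" shows "pair L (sroot i) b = b i - b (Suc i)"
proof -
  have "sroot i t * b t = (if t = i then b i else 0) + (if t = Suc i then - b (Suc i) else 0)" for t
    by (auto simp: sroot_def)
  then show ?thesis
    using assms unfolding pair_def by (simp add: sum.distrib) auto
qed

lemma pair_commute: "pair L a b = pair L b a"
  by (simp add: pair_def mult.commute)

lemma Cartan_matrix:
  assumes "i \<in> {1..L-1}" "j \<in> {1..L-1}"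
  shows "pair L (sroot i) (sroot j) =
    2 * of_bool (i = j) - of_bool (i = j + 1) - of_bool (j = i + 1)"
  by (subst pair_sroot[OF assms(1)]) (auto simp: sroot_def)

lemma pair_sroot_Hw:
  assumes "i \<in> {1..L-1}" "s \<in> {1..L}"
  shows "pair L (sroot i) (Hw L s) = of_bool (i = s) - of_bool (i + 1 = s)"
  using assms(2) by (subst pair_sroot[OF assms(1)]) (use assms in \<open>auto simp: Hw_def\<close>)

lemma sum_Hw: "(\<Sum>s=1..L. Hw L s t) = 0"
  by (cases "t \<in> {1..L}") (auto simp: Hw_def sum_subtractf)

lemma wrefl_in_hdual:
  assumes "i \<in> {1..L-1}" "a \<in> hdual L" shows "wrefl L i a \<in> hdual L"
  using assms sroot_in_hdual[OF assms(1)]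
  by (auto simp: wrefl_def hdual_def sum_subtractf simp flip: sum_distrib_left)

lemma wrefl_wrefl:
  assumes i: "i \<in> {1..L-1}" and a: "a \<in> hdual L" shows "wrefl L i (wrefl L i a) = a"
proof -
  define c where "c = pair L a (sroot i)"
  have r: "wrefl L i a = (\<lambda>t. a t - c * sroot i t)"
    using a by (simp add: wrefl_def c_def)
  have "pair L (wrefl L i a) (sroot i) = - c"
    unfolding r c_def pair_commute[of L _ "sroot i"] pair_sroot[OF i]
    by (simp add: sroot_def)
  moreover have "wrefl L i (wrefl L i a) =
      (\<lambda>t. wrefl L i a t - pair L (wrefl L i a) (sroot i) * sroot i t)"
    using wrefl_in_hdual[OF i a] by (subst wrefl_def) simp
  ultimately show ?thesis by (simp add: r)
qed

lemma wrefl_in_Bij: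
  assumes i: "i \<in> {1..L-1}" shows "wrefl L i \<in> carrier (BijGroup (hdual L))"
proof -
  have "bij_betw (wrefl L i) (hdual L) (hdual L)"
    by (rule bij_betwI[where g = "wrefl L i"])
       (simp_all add: wrefl_in_hdual[OF i] wrefl_wrefl[OF i])
  then show ?thesis
    by (simp add: BijGroup_def Bij_def wrefl_def)
qed


subsection \<open>Polynomial algebras\<close>

text \<open>
  \<^typ>\<open>('v \<Rightarrow>\<^sub>0 nat) \<Rightarrow>\<^sub>0 complex\<close> is the ring of complex polynomials in variables of type
  \<^typ>\<open>'v\<close>: monomials are finitely supported exponent functions.
\<close>

definition mconst :: "complex \<Rightarrow> ('v \<Rightarrow>\<^sub>0 nat) \<Rightarrow>\<^sub>0 complex" where
  "mconst c = Poly_Mapping.single 0 c"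

definition mvar :: "'v \<Rightarrow> ('v \<Rightarrow>\<^sub>0 nat) \<Rightarrow>\<^sub>0 complex" where
  "mvar v = Poly_Mapping.single (Poly_Mapping.single v 1) 1"

definition msubst ::
    "('v \<Rightarrow> ('w \<Rightarrow>\<^sub>0 nat) \<Rightarrow>\<^sub>0 complex) \<Rightarrow>
     (('v \<Rightarrow>\<^sub>0 nat) \<Rightarrow>\<^sub>0 complex) \<Rightarrow> (('w \<Rightarrow>\<^sub>0 nat) \<Rightarrow>\<^sub>0 complex)" where
  "msubst \<phi> h = (\<Sum>t\<in>Poly_Mapping.keys h. mconst (Poly_Mapping.lookup h t) *
     (\<Prod>v\<in>Poly_Mapping.keys t. \<phi> v ^ Poly_Mapping.lookup t v))"

text \<open>
  \<open>\<A>\<close> is the subring of this ring generated by \<open>\<complex>\<close> and the generators \<open>gen i m\<close>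
  (\<open>= \<alpha>\<^sub>i c\<^bsub>-m\<^esub>\<close>) with \<open>1 \<le> i \<le> L - 1\<close> and \<open>m \<ge> 1\<close>.
\<close>

type_synonym hpoly = "(nat \<times> nat \<Rightarrow>\<^sub>0 nat) \<Rightarrow>\<^sub>0 complex"

definition gen :: "nat \<Rightarrow> nat \<Rightarrow> hpoly" where
  "gen i m = mvar (i, m)"

definition algA :: "nat \<Rightarrow> hpoly set" where
  "algA L = {h. \<forall>t\<in>Poly_Mapping.keys h. Poly_Mapping.keys t \<subseteq> {1..L-1} \<times> {1..}}"

type_synonym rpoly = "(nat \<Rightarrow>\<^sub>0 nat) \<Rightarrow>\<^sub>0 complex"
type_synonym rfun = "rpoly fract"

text \<open>
  \<^typ>\<open>rpoly\<close> has variables \<open>x\<^sub>1, x\<^sub>2, \<dots>\<close>, and \<^typ>\<open>rfun\<close> is its field of fractions. The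
  identities for \<open>J\<close> take place in the subfield generated by \<open>x\<^sub>1, \<dots>, x\<^sub>N\<close>.
\<close>

definition rconst :: "complex \<Rightarrow> rfun" where
  "rconst c = to_fract (mconst c)"

lemma msubst_superset:
  assumes "finite A" "Poly_Mapping.keys h \<subseteq> A"
  shows "msubst \<phi> h = (\<Sum>t\<in>A. mconst (Poly_Mapping.lookup h t) *
     (\<Prod>v\<in>Poly_Mapping.keys t. \<phi> v ^ Poly_Mapping.lookup t v))"
  unfolding msubst_def using assms
  by (intro sum.mono_neutral_left) (auto simp: mconst_def in_keys_iff)

lemma mconst_add: "mconst (c + d) = mconst c + mconst d"
  by (simp add: mconst_def single_add)

lemma mconst_mult: "mconst (c * d) = mconst c * mconst d"
  by (simp add: mconst_def mult_single)

lemma mconst_1 [simp]: "mconst 1 = 1"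
  by (simp add: mconst_def)

lemma msubst_0: "msubst \<phi> 0 = 0"
  by (simp add: msubst_def)

lemma msubst_add: "msubst \<phi> (g + h) = msubst \<phi> g + msubst \<phi> h"
proof -
  let ?A = "Poly_Mapping.keys g \<union> Poly_Mapping.keys h"
  have "msubst \<phi> (g + h) = (\<Sum>t\<in>?A. mconst (Poly_Mapping.lookup (g + h) t) *
     (\<Prod>v\<in>Poly_Mapping.keys t. \<phi> v ^ Poly_Mapping.lookup t v))"
    by (rule msubst_superset) (auto dest: subsetD[OF keys_add])
  then show ?thesis
    by (simp add: msubst_superset[of ?A] lookup_add mconst_add distrib_right sum.distrib)
qed

lemma msubst_single:
  "msubst \<phi> (Poly_Mapping.single t c) =
     mconst c * (\<Prod>v\<in>Poly_Mapping.keys t. \<phi> v ^ Poly_Mapping.lookup t v)"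
  by (subst msubst_superset[of "{t}"]) auto

lemma msubst_mconst [simp]: "msubst \<phi> (mconst c) = mconst c"
  by (simp add: mconst_def msubst_single)

lemma msubst_mvar [simp]: "msubst \<phi> (mvar v) = \<phi> v"
  by (simp add: mvar_def msubst_single)

lemma poly_mapping_single_induct:
  fixes h :: "'a \<Rightarrow>\<^sub>0 'b::monoid_add"
  assumes "P 0" "\<And>t c h. P h \<Longrightarrow> P (h + Poly_Mapping.single t c)"
  shows "P h"
proof (induction h rule: Poly_Mapping.update_induct)
  case const
  show ?case by (rule assms(1))
next
  case (update f a b)
  have "Poly_Mapping.update a b f = f + Poly_Mapping.single a b"
    using update(1)
    by (intro poly_mapping_eqI) (auto simp: lookup_update lookup_add lookup_single when_def in_keys_iff)
  then show ?case by (simp add: assms(2) update(3))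
qed

lemma msubst_mult: "msubst \<phi> (g * h) = msubst \<phi> g * msubst \<phi> h"
proof -
  let ?M = "\<lambda>t. \<Prod>v\<in>Poly_Mapping.keys t. \<phi> v ^ Poly_Mapping.lookup t v"
  have sup: "?M t = (\<Prod>v\<in>A. \<phi> v ^ Poly_Mapping.lookup t v)"
    if "finite A" "Poly_Mapping.keys t \<subseteq> A" for A t
    using that by (intro prod.mono_neutral_left) (auto simp: in_keys_iff)
  have M: "?M (s + t) = ?M s * ?M t" for s t
  proof -
    let ?A = "Poly_Mapping.keys s \<union> Poly_Mapping.keys t"
    have "?M (s + t) = (\<Prod>v\<in>?A. \<phi> v ^ Poly_Mapping.lookup (s + t) v)"
      by (rule sup) (auto dest: subsetD[OF keys_add])
    then show ?thesis
      by (simp add: sup[of ?A] lookup_add power_add prod.distrib)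
  qed
  have 1: "msubst \<phi> (Poly_Mapping.single s c * h) = msubst \<phi> (Poly_Mapping.single s c) * msubst \<phi> h"
    for s c
    by (induction h rule: poly_mapping_single_induct)
       (simp_all add: mult_single msubst_single M mconst_mult msubst_add msubst_0 distrib_left mult_ac)
  show ?thesis
    by (induction g rule: poly_mapping_single_induct) (simp_all add: 1 msubst_0 msubst_add distrib_right)
qed


subsection \<open>The rational functions J\<close>

definition ff :: "nat \<Rightarrow> real \<Rightarrow> rfun \<Rightarrow> rfun" where
  "ff L p z = (z - rconst (om L (of_real p))) * (z - rconst (om L (of_real (1 - p)))) /
     ((z - 1) * (z - rconst (om L 1)))"

definition elt :: "nat set \<Rightarrow> nat \<Rightarrow> nat" where
  "elt S j = sorted_list_of_set S ! (j - 1)"  \<comment> \<open>the \<open>j\<close>-th smallest element, counted from 1\<close>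

definition yy :: "nat \<Rightarrow> (nat \<Rightarrow> nat) \<Rightarrow> nat \<Rightarrow> nat \<Rightarrow> rpoly" where
  "yy L k n j = mvar n * mconst (om L ((of_nat (k n) + 1 - 2 * of_nat j) / 2))"

definition EE :: "nat \<Rightarrow> (nat \<Rightarrow> nat) \<Rightarrow> nat \<Rightarrow> (nat \<Rightarrow> nat set) \<Rightarrow> hpoly \<Rightarrow> rpoly" where
  "EE L k N S = msubst (\<lambda>(i, m). \<Sum>n=1..N. \<Sum>j=1..k n.
     mconst (pair L (sroot i) (Hw L (elt (S n) j)) *
       om L (- ((of_nat L + 1 - 2 * of_nat (elt (S n) j)) / 2) * of_nat m)) *
     yy L k n j ^ m)"

definition Phi :: "nat \<Rightarrow> real \<Rightarrow> (nat \<Rightarrow> nat) \<Rightarrow> nat \<Rightarrow> (nat \<Rightarrow> nat set) \<Rightarrow> rfun" where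
  "Phi L p k N S =
    (\<Prod>n=1..N. \<Prod>m\<in>{1..<n}. \<Prod>j=1..k m. \<Prod>j'=1..k n.
       let s = elt (S m) j; s' = elt (S n) j';
           u = to_fract (yy L k m j); v = to_fract (yy L k n j')
       in if s < s' then ff L p (u / v) else if s' < s then ff L p (v / u) else 1)"

definition tuples :: "nat \<Rightarrow> (nat \<Rightarrow> nat) \<Rightarrow> nat \<Rightarrow> (nat \<Rightarrow> nat set) set" where
  "tuples L k N = (\<Pi>\<^sub>E n\<in>{1..N}. {S. S \<subseteq> {1..L} \<and> card S = k n})"

definition JJ :: "nat \<Rightarrow> real \<Rightarrow> hpoly \<Rightarrow> nat \<Rightarrow> (nat \<Rightarrow> complex) \<Rightarrow> (nat \<Rightarrow> nat) \<Rightarrow> rfun" where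
  "JJ L p h N a k = (\<Sum>S\<in>tuples L k N.
     rconst (om L (pair L a (\<lambda>t. \<Sum>n=1..N. HS L (S n) t))) *
     Phi L p k N S * to_fract (EE L k N S h))"


subsection \<open>The elements h\<close>

definition KK :: "nat \<Rightarrow> nat \<Rightarrow> (nat \<Rightarrow> complex) \<Rightarrow> complex" where
  "KK L k a = (\<Sum>S | S \<subseteq> {1..L} \<and> card S = k. om L (pair L a (HS L S)))"

text \<open>
  \<open>c \<sigma>\<close> for \<open>\<sigma> \<in> {1..L-2}\<close> is a family of vectors in \<open>\<complex>\<^bsup>L-1\<^esup>\<close> (only the components
  \<open>c \<sigma> k\<close> with \<open>k \<in> {1..L-1}\<close> matter).
\<close>

definition sol_basis :: "nat \<Rightarrow> (nat \<Rightarrow> nat \<Rightarrow> complex) \<Rightarrow> bool" where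
  "sol_basis L c \<longleftrightarrow>
     (\<forall>\<sigma>\<in>{1..L-2}. (\<Sum>k=1..L-1. c \<sigma> k) = 0) \<and>
     (\<forall>d. (\<forall>k\<in>{1..L-1}. (\<Sum>\<sigma>=1..L-2. d \<sigma> * c \<sigma> k) = 0) \<longrightarrow> (\<forall>\<sigma>\<in>{1..L-2}. d \<sigma> = 0)) \<and>
     (\<forall>v. (\<Sum>k=1..L-1. v k) = 0 \<longrightarrow>
        (\<exists>d. \<forall>k\<in>{1..L-1}. v k = (\<Sum>\<sigma>=1..L-2. d \<sigma> * c \<sigma> k)))"

definition iota1 :: "nat \<Rightarrow> hpoly" where
  "iota1 L = (\<Sum>i=1..L-1. mconst (om L ((of_nat L - of_nat i) / 2) * qnum L i) * gen i 1)"

definition h1 :: "nat \<Rightarrow> (nat \<Rightarrow> nat \<Rightarrow> complex) \<Rightarrow> nat \<Rightarrow> (nat \<Rightarrow> complex) \<Rightarrow> hpoly" where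
  "h1 L c \<sigma> a = (if \<sigma> = L - 1 then iota1 L else
     - (\<Sum>i=1..L-1. gen i 1 * mconst (\<Sum>k=1..L-1. c \<sigma> k / (qnum L k * KK L k a) *
         (\<Sum>m=1..k. om L (of_nat m - of_nat i - (of_nat k + 1) / 2) *
           (\<Sum>S | S \<subseteq> {1..L} \<and> card S = k \<and> elt S m > i. om L (pair L a (HS L S)))))))"

lemma algA_add: "g \<in> algA L \<Longrightarrow> h \<in> algA L \<Longrightarrow> g + h \<in> algA L"
  unfolding algA_def using keys_add[of g h] by blast

lemma algA_sum: "(\<And>x. x \<in> A \<Longrightarrow> g x \<in> algA L) \<Longrightarrow> sum g A \<in> algA L"
proof (induction A rule: infinite_finite_induct)
  case (insert x A)
  then show ?case by (simp add: algA_add)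
qed (simp_all add: algA_def)

lemma algA_const_gen:
  assumes "i \<in> {1..L-1}" "m \<ge> 1" shows "mconst c * gen i m \<in> algA L"
  using assms by (auto simp: algA_def mconst_def gen_def mvar_def mult_single)

lemma iota1_in_algA: "iota1 L \<in> algA L"
  unfolding iota1_def by (intro algA_sum algA_const_gen) auto

lemma h1_in_algA: "h1 L c \<sigma> a \<in> algA L"
proof -
  have "- h \<in> algA L" if "h \<in> algA L" for h
    using that by (simp add: algA_def)
  moreover have "(\<Sum>i=1..L-1. gen i 1 * mconst (x i)) \<in> algA L" for x
    by (subst mult.commute, intro algA_sum algA_const_gen) auto
  ultimately show ?thesis
    by (simp add: h1_def iota1_in_algA)
qed

end

theory Submission
  imports Defs
begin

text \<open>
  On \<open>\<hh>\<^sup>*\<close> a simple reflection \<open>w\<^sub>i\<close> exchanges the coordinates \<open>a\<^sub>i\<close> and \<open>a\<^bsub>i+1\<^esub>\<close>. Group the tuples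
  \<open>S\<close> by what remains after forgetting, in each component containing exactly one of \<open>i, i + 1\<close>, which
  of the two it is. With \<open>X\<close> the set of these components, \<open>I \<subseteq> X\<close> those containing \<open>i\<close>,
  \<open>A = \<omega>\<^bsup>a\<^sub>i\<^esup>\<close> and \<open>B = \<omega>\<^bsup>a\<^sub>i\<^sub>+\<^sub>1\<^esup>\<close>, the inner sum becomes, up to a common factor,
  \<open>\<Sum>\<^sub>I A\<^bsup>|I|\<^esup> B\<^bsup>|X-I|\<^esup> \<Prod>\<^bsub>m\<in>I, n\<notin>I\<^esub> f(y\<^sub>m/y\<^sub>n)\<close>, because \<open>f(\<omega>/z) = f(z)\<close> makes the interaction with
  components containing both \<open>i\<close> and \<open>i + 1\<close> independent of \<open>I\<close>. This sum is symmetric in \<open>A\<close> and \<open>B\<close>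
  (Ruijsenaars): a partial fraction expansion in one variable expresses it through the sums over
  smaller sets with coefficients symmetric in \<open>A, B\<close>.

  For \<open>h\<^bsub>1,a\<^esub>\<close> the coefficient of \<open>y\<close> contributed by an element \<open>s\<close> is, up to a constant, a combination of
  the sums of \<open>\<omega>\<^bsup>\<langle>a,H\<^sub>S\<rangle> + |{t\<in>S. t<s}|\<^esup>\<close> over \<open>S \<notni> s\<close>. It equals \<open>U + V B\<close> for \<open>s = i\<close> and \<open>U + \<omega> V A\<close> for
  \<open>s = i + 1\<close>, and is invariant for all other \<open>s\<close>, so one also needs the symmetry of the above sum weighted
  with \<open>B y(I) + \<omega> A y(X - I)\<close>; that is the \<open>1/t\<close> term of the same partial fraction expansion.
\<close>

section \<open>Partial fractions of a product with two simple poles per factor\<close>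

text \<open>The residue at a pole is that of its own factor times the other factors evaluated there.
  Since no limits are available over an arbitrary field, the expansion and the comparison of the
  coefficients of \<open>1 / t\<close> at infinity are proved algebraically, by one induction on
  \<open>J\<close>.\<close>

lemma partial_fractions:
  fixes p q u v :: "'i \<Rightarrow> 'a::field" and g :: "'i \<Rightarrow> 'a \<Rightarrow> 'a"
  assumes "finite J"
    and g: "\<And>j t. j \<in> J \<Longrightarrow> t \<noteq> p j \<Longrightarrow> t \<noteq> q j \<Longrightarrow> g j t = 1 + u j / (t - p j) + v j / (t - q j)"
    and sep: "\<And>i j. i \<in> J \<Longrightarrow> j \<in> J \<Longrightarrow> i \<noteq> j \<Longrightarrow> {p i, q i} \<inter> {p j, q j} = {}"
  shows "(\<forall>j\<in>J. t \<noteq> p j \<and> t \<noteq> q j) \<Longrightarrow> (\<Prod>j\<in>J. g j t) =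
      1 + (\<Sum>j\<in>J. u j * (\<Prod>i\<in>J-{j}. g i (p j)) / (t - p j)
                + v j * (\<Prod>i\<in>J-{j}. g i (q j)) / (t - q j))"
    and "(\<Sum>j\<in>J. u j * (\<Prod>i\<in>J-{j}. g i (p j)) + v j * (\<Prod>i\<in>J-{j}. g i (q j))) =
      (\<Sum>j\<in>J. u j + v j)"
proof -
  \<comment> \<open>\<open>t\<close> is quantified inside the induction, because the hypothesis is
    evaluated at the poles \<open>p x\<close> and \<open>q x\<close> of the new factor.\<close>
  have "(\<forall>t. (\<forall>j\<in>J. t \<noteq> p j \<and> t \<noteq> q j) \<longrightarrow> (\<Prod>j\<in>J. g j t) =
      1 + (\<Sum>j\<in>J. u j * (\<Prod>i\<in>J-{j}. g i (p j)) / (t - p j)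
                + v j * (\<Prod>i\<in>J-{j}. g i (q j)) / (t - q j))) \<and>
    (\<Sum>j\<in>J. u j * (\<Prod>i\<in>J-{j}. g i (p j)) + v j * (\<Prod>i\<in>J-{j}. g i (q j))) =
      (\<Sum>j\<in>J. u j + v j)"
    using assms
  proof (induction J)
    case empty
    then show ?case by simp
  next
    case (insert x J)
    define a where "a j = u j * (\<Prod>i\<in>J-{j}. g i (p j))" for j
    define b where "b j = v j * (\<Prod>i\<in>J-{j}. g i (q j))" for j
    have IH: "(\<Prod>j\<in>J. g j t) = 1 + (\<Sum>j\<in>J. a j / (t - p j) + b j / (t - q j))"
      if "\<forall>j\<in>J. t \<noteq> p j \<and> t \<noteq> q j" for t
      using insert.IH insert.prems that unfolding a_def b_def by auto
    have IH2: "(\<Sum>j\<in>J. a j + b j) = (\<Sum>j\<in>J. u j + v j)"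
      using insert.IH insert.prems unfolding a_def b_def by auto
    have sepx: "p j \<noteq> p x" "p x \<noteq> p j" "p j \<noteq> q x" "q x \<noteq> p j" "q j \<noteq> q x" "q x \<noteq> q j"
      "p x \<noteq> q j" "q j \<noteq> p x" if "j \<in> J" for j
      using insert.prems(2)[of j x] insert.hyps(2) that by (cases "j = x"; auto)+
    have gx: "g x t = 1 + u x / (t - p x) + v x / (t - q x)" if "t \<noteq> p x" "t \<noteq> q x" for t
      using insert.prems(1)[of x] that by auto
    have Px: "(\<Prod>i\<in>J. g i (p x)) = 1 + (\<Sum>j\<in>J. a j / (p x - p j) + b j / (p x - q j))"
      using sepx by (intro IH) auto
    have Qx: "(\<Prod>i\<in>J. g i (q x)) = 1 + (\<Sum>j\<in>J. a j / (q x - p j) + b j / (q x - q j))"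
      using sepx by (intro IH) auto
    have rm: "(\<Prod>i\<in>insert x J-{j}. g i s) = g x s * (\<Prod>i\<in>J-{j}. g i s)" if "j \<in> J" for j s
    proof -
      have "insert x J - {j} = insert x (J - {j})" using that insert.hyps by auto
      then show ?thesis using insert.hyps by simp
    qed
    have rx: "insert x J - {x} = J" using insert.hyps by auto
    have A: "u j * (\<Prod>i\<in>insert x J-{j}. g i (p j)) = a j * g x (p j)"
            "v j * (\<Prod>i\<in>insert x J-{j}. g i (q j)) = b j * g x (q j)" if "j \<in> J" for j
      using rm[OF that] by (simp_all add: a_def b_def)
    \<comment> \<open>Splits each product of a pole of \<open>g x\<close> with a pole from the
      induction hypothesis. The terms at \<open>p x\<close> and \<open>q x\<close> reassemble the
      expansions \<open>Px\<close> and \<open>Qx\<close>; those at \<open>p j\<close> and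
      \<open>q j\<close> reassemble the factors \<open>g x (p j)\<close> and
      \<open>g x (q j)\<close>.\<close>
    have pf: "d * c / ((t - s) * (t - r)) = d * c / ((s - r) * (t - s)) + d * c / ((r - s) * (t - r))"
      if "t \<noteq> s" "t \<noteq> r" "s \<noteq> r" for c d s r t :: 'a
    proof -
      have "t - s \<noteq> 0" "t - r \<noteq> 0" "s - r \<noteq> 0" "r - s = - (s - r)" using that by auto
      then show ?thesis by (simp add: divide_simps) (simp add: algebra_simps)
    qed
    have part1: "(\<Prod>j\<in>insert x J. g j t) =
      1 + (\<Sum>j\<in>insert x J. u j * (\<Prod>i\<in>insert x J-{j}. g i (p j)) / (t - p j)
                + v j * (\<Prod>i\<in>insert x J-{j}. g i (q j)) / (t - q j))"
      if t: "\<forall>j\<in>insert x J. t \<noteq> p j \<and> t \<noteq> q j" for t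
    proof -
      have "(\<Prod>j\<in>insert x J. g j t) =
         (1 + u x / (t - p x) + v x / (t - q x)) * (1 + (\<Sum>j\<in>J. a j / (t - p j) + b j / (t - q j)))"
        using insert.hyps t by (simp add: gx IH)
      also have "\<dots> = 1 + u x / (t - p x) + v x / (t - q x) +
         (\<Sum>j\<in>J. a j / (t - p j) + b j / (t - q j) +
            u x / (t - p x) * (a j / (t - p j)) + u x / (t - p x) * (b j / (t - q j)) +
            v x / (t - q x) * (a j / (t - p j)) + v x / (t - q x) * (b j / (t - q j)))"
        by (simp add: algebra_simps sum_distrib_left sum.distrib)
      also have "(\<Sum>j\<in>J. a j / (t - p j) + b j / (t - q j) +
            u x / (t - p x) * (a j / (t - p j)) + u x / (t - p x) * (b j / (t - q j)) +
            v x / (t - q x) * (a j / (t - p j)) + v x / (t - q x) * (b j / (t - q j))) =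
          (\<Sum>j\<in>J. u x * (a j / (p x - p j) + b j / (p x - q j)) / (t - p x)
             + v x * (a j / (q x - p j) + b j / (q x - q j)) / (t - q x)
             + (a j * g x (p j) / (t - p j) + b j * g x (q j) / (t - q j)))"
      proof (intro sum.cong refl)
        fix j assume j: "j \<in> J"
        have ne: "t \<noteq> p x" "t \<noteq> q x" "t \<noteq> p j" "t \<noteq> q j" using t j by auto
        note s = sepx[OF j]
        show "a j / (t - p j) + b j / (t - q j) +
            u x / (t - p x) * (a j / (t - p j)) + u x / (t - p x) * (b j / (t - q j)) +
            v x / (t - q x) * (a j / (t - p j)) + v x / (t - q x) * (b j / (t - q j)) =
           u x * (a j / (p x - p j) + b j / (p x - q j)) / (t - p x)
             + v x * (a j / (q x - p j) + b j / (q x - q j)) / (t - q x)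
             + (a j * g x (p j) / (t - p j) + b j * g x (q j) / (t - q j))"
          using s ne
          by (simp add: gx distrib_left add_divide_distrib) (simp add: pf mult.commute)
      qed
      finally show ?thesis
        using insert.hyps
        by (simp add: rx A Px Qx cong: sum.cong)
           (simp add: sum.distrib sum_distrib_left sum_divide_distrib distrib_left add_divide_distrib add_ac)
    qed
    have part2: "(\<Sum>j\<in>insert x J. u j * (\<Prod>i\<in>insert x J-{j}. g i (p j)) + v j * (\<Prod>i\<in>insert x J-{j}. g i (q j))) =
      (\<Sum>j\<in>insert x J. u j + v j)"
    proof -
      have flip: "c * (d / (s - r)) = - (d * (c / (r - s)))" for c d s r :: 'a
        by (metis minus_diff_eq mult.commute divide_minus_right times_divide_eq_left
            times_divide_eq_right minus_divide_left minus_mult_commute minus_minus)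
      \<comment> \<open>Every cross term occurs twice with opposite signs: in \<open>g x\<close>
        evaluated at an old pole and in \<open>Px\<close> or \<open>Qx\<close>, the expansion at a
        new pole.\<close>
      have "(\<Sum>j\<in>J. a j * g x (p j) + b j * g x (q j)) = (\<Sum>j\<in>J. (a j + b j)
          - (u x * (a j / (p x - p j)) + u x * (b j / (p x - q j))
             + v x * (a j / (q x - p j)) + v x * (b j / (q x - q j))))"
      proof (intro sum.cong refl)
        fix j assume j: "j \<in> J"
        note s = sepx[OF j]
        show "a j * g x (p j) + b j * g x (q j) = (a j + b j)
          - (u x * (a j / (p x - p j)) + u x * (b j / (p x - q j))
             + v x * (a j / (q x - p j)) + v x * (b j / (q x - q j)))"
          unfolding flip[of "u x"] flip[of "v x"] using s by (simp add: gx algebra_simps)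
      qed
      then show ?thesis
        using insert.hyps
        by (simp add: rx A Px Qx IH2[symmetric] cong: sum.cong)
           (simp add: sum.distrib sum_subtractf sum_distrib_left algebra_simps)
    qed
    from part1 part2 show ?case by blast
  qed
  then show "(\<forall>j\<in>J. t \<noteq> p j \<and> t \<noteq> q j) \<Longrightarrow> (\<Prod>j\<in>J. g j t) =
      1 + (\<Sum>j\<in>J. u j * (\<Prod>i\<in>J-{j}. g i (p j)) / (t - p j)
                + v j * (\<Prod>i\<in>J-{j}. g i (q j)) / (t - q j))"
    and "(\<Sum>j\<in>J. u j * (\<Prod>i\<in>J-{j}. g i (p j)) + v j * (\<Prod>i\<in>J-{j}. g i (q j))) =
      (\<Sum>j\<in>J. u j + v j)" by blast+
qed

subsection \<open>Ruijsenaars' functional identity\<close>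

text \<open>Together with \<open>sum_Pow_swap\<close> this indexes all terms attached to an element
  \<open>n\<close> by the subsets without \<open>n\<close>, so that the terms of \<open>I\<close>
  and of \<open>insert n I\<close> can be added.\<close>

lemma sum_Pow_compl_swap:
  assumes "finite X"
  shows "(\<Sum>I\<in>Pow X. \<Sum>j\<in>X-I. F I j) = (\<Sum>n\<in>X. \<Sum>I\<in>Pow (X-{n}). F I n)"
proof -
  have "(\<Sum>I\<in>Pow X. \<Sum>j\<in>{j\<in>X. j \<notin> I}. F I j) = (\<Sum>n\<in>X. \<Sum>I\<in>{I\<in>Pow X. n \<notin> I}. F I n)"
    using assms by (intro sum.swap_restrict) auto
  moreover have "{I\<in>Pow X. n \<notin> I} = Pow (X-{n})" for n by auto
  ultimately show ?thesis by (simp add: set_diff_eq)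
qed

lemma sum_Pow_swap:
  assumes "finite X"
  shows "(\<Sum>I\<in>Pow X. \<Sum>i\<in>I. F I i) = (\<Sum>n\<in>X. \<Sum>I\<in>Pow (X-{n}). F (insert n I) n)"
proof -
  have "(\<Sum>I\<in>Pow X. \<Sum>i\<in>I. F I i) = (\<Sum>I\<in>Pow X. \<Sum>i\<in>{i\<in>X. i \<in> I}. F I i)"
    by (intro sum.cong) auto
  also have "\<dots> = (\<Sum>n\<in>X. \<Sum>I\<in>{I\<in>Pow X. n \<in> I}. F I n)"
    using assms by (intro sum.swap_restrict) auto
  also have "\<dots> = (\<Sum>n\<in>X. \<Sum>I\<in>Pow (X-{n}). F (insert n I) n)"
  proof (rule sum.cong[OF refl])
    fix n assume "n \<in> X"
    then show "(\<Sum>I\<in>{I\<in>Pow X. n \<in> I}. F I n) = (\<Sum>I\<in>Pow (X-{n}). F (insert n I) n)"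
      by (intro sum.reindex_bij_witness[where i = "insert n" and j = "\<lambda>I. I - {n}"]) (auto simp: insert_absorb)
  qed
  finally show ?thesis .
qed

text \<open>Off its poles 1 and \<omega>, \<open>f\<close> is given by its partial fractions. The
  residues \<alpha> and -\<omega>\<alpha> are in the ratio that makes \<open>f\<close> equal to 1 at
  0 as well as at infinity.\<close>

locale ruijsenaars =
  fixes f :: "'a::field \<Rightarrow> 'a" and \<alpha> \<omega> :: 'a
  assumes \<omega>_nz: "\<omega> \<noteq> 0"
    and f_eq: "\<And>z. z \<noteq> 1 \<Longrightarrow> z \<noteq> \<omega> \<Longrightarrow> f z = 1 + \<alpha> / (z - 1) - \<omega> * \<alpha> / (z - \<omega>)"
begin

text \<open>The substitution of \<omega> / z for z interchanges the two poles, and the ratio of the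
  residues matches it.\<close>

lemma f_reflect:
  assumes "z \<noteq> 0" "z \<noteq> 1" "z \<noteq> \<omega>"
  shows "f (\<omega> / z) = f z"
proof -
  have "\<omega> / z \<noteq> 1" "\<omega> / z \<noteq> \<omega>" using assms \<omega>_nz by (auto simp: divide_simps)
  then have "f (\<omega> / z) = 1 + \<alpha> / (\<omega> / z - 1) - \<omega> * \<alpha> / (\<omega> / z - \<omega>)"
    by (rule f_eq)
  also have "\<alpha> / (\<omega> / z - 1) = - \<alpha> - \<omega> * \<alpha> / (z - \<omega>)"
    using assms by (simp add: divide_simps) (simp add: algebra_simps)
  also have "\<omega> * \<alpha> / (\<omega> / z - \<omega>) = - \<alpha> - \<alpha> / (z - 1)"
    using assms \<omega>_nz by (simp add: divide_simps) (simp add: algebra_simps)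
  finally show ?thesis using assms by (simp add: f_eq)
qed

text \<open>Keeps every ratio \<open>y m / y n\<close> with m \<noteq> n away from 0 and from the
  poles 1 and \<omega> of \<open>f\<close>. As both orders occur, the ratios also avoid 1 /
  \<omega>.\<close>

definition generic :: "'i set \<Rightarrow> ('i \<Rightarrow> 'a) \<Rightarrow> bool" where
  "generic X y \<longleftrightarrow> (\<forall>m\<in>X. y m \<noteq> 0 \<and> (\<forall>n\<in>X. m \<noteq> n \<longrightarrow> y m \<noteq> y n \<and> y m \<noteq> \<omega> * y n))"

lemma genericD:
  assumes "generic X y" "m \<in> X" "n \<in> X" "m \<noteq> n"
  shows "y m \<noteq> 0" "y n \<noteq> 0" "y m \<noteq> y n" "y n \<noteq> y m" "y m \<noteq> \<omega> * y n" "y n \<noteq> \<omega> * y m"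
  using assms unfolding generic_def by auto

lemma generic_subset: "generic X y \<Longrightarrow> Y \<subseteq> X \<Longrightarrow> generic Y y"
  unfolding generic_def by blast

text \<open>Turns a factor evaluated at a shifted pole back into an ordinary factor with the ratio
  inverted.\<close>

lemma f_reflect_ratio:
  assumes "generic X y" "m \<in> X" "n \<in> X" "m \<noteq> n"
  shows "f (\<omega> * y m / y n) = f (y n / y m)"
proof -
  note d = genericD[OF assms]
  have "f (\<omega> / (y n / y m)) = f (y n / y m)"
    using d by (intro f_reflect) (auto simp: divide_simps)
  then show ?thesis by simp
qed

lemma f_ratio:
  assumes "t \<noteq> s" "t \<noteq> \<omega> * s" "s \<noteq> 0"
  shows "f (t / s) = 1 + \<alpha> * s / (t - s) + (- \<omega> * \<alpha> * s) / (t - \<omega> * s)"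
proof -
  have "t / s \<noteq> 1" "t / s \<noteq> \<omega>" using assms by (auto simp: divide_simps)
  then have "f (t / s) = 1 + \<alpha> / (t / s - 1) - \<omega> * \<alpha> / (t / s - \<omega>)" by (rule f_eq)
  also have "\<alpha> / (t / s - 1) = \<alpha> * s / (t - s)" using assms by (simp add: divide_simps)
  also have "\<omega> * \<alpha> / (t / s - \<omega>) = \<omega> * \<alpha> * s / (t - \<omega> * s)" using assms by (simp add: divide_simps)
  finally show ?thesis by simp
qed

text \<open>As a function of \<open>t\<close> the left side has poles at \<open>s\<close> and
  \<open>s / \<omega>\<close>; its constant term is again 1 because \<open>f 0 = 1\<close>.\<close>

lemma f_ratio_inverse:
  assumes "t \<noteq> s" "t \<noteq> s / \<omega>" "s \<noteq> 0"
  shows "f (s / t) = 1 + (- \<alpha> * s) / (t - s) + (\<alpha> * s / \<omega>) / (t - s / \<omega>)"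
proof (cases "t = 0")
  case True
  \<comment> \<open>Here \<open>s / t\<close> is 0 by convention, and both sides equal 1. The case
    is included because \<open>partial_fractions\<close> asks for the form of a factor at every
    \<open>t\<close> off its poles.\<close>
  have "f 0 = 1 + \<alpha> / (0 - 1) - \<omega> * \<alpha> / (0 - \<omega>)"
    using \<omega>_nz by (intro f_eq) auto
  then show ?thesis using True assms \<omega>_nz by simp
next
  case False
  have "s / t \<noteq> 1" "s / t \<noteq> \<omega>" using assms False \<omega>_nz by (auto simp: divide_simps)
  then have "f (s / t) = 1 + \<alpha> / (s / t - 1) - \<omega> * \<alpha> / (s / t - \<omega>)" by (rule f_eq)
  also have "\<alpha> / (s / t - 1) = - \<alpha> + (- \<alpha> * s) / (t - s)"
    using assms False by (simp add: divide_simps) (simp add: algebra_simps)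
  also have "\<omega> * \<alpha> / (s / t - \<omega>) = - \<alpha> - (\<alpha> * s / \<omega>) / (t - s / \<omega>)"
  proof -
    have "s - t * \<omega> \<noteq> 0" "t * \<omega> - s \<noteq> 0" using assms \<omega>_nz by (auto simp: divide_simps)
    then show ?thesis
      using assms False \<omega>_nz by (simp add: divide_simps) (simp add: algebra_simps)
  qed
  finally show ?thesis by simp
qed

text \<open>\<open>J\<close> is an argument of its own instead of \<open>X - I\<close>, so that an
  element can be added to one side alone.\<close>

definition subset_weight :: "'a \<Rightarrow> 'a \<Rightarrow> ('i \<Rightarrow> 'a) \<Rightarrow> 'i set \<Rightarrow> 'i set \<Rightarrow> 'a" where
  "subset_weight A B y I J = A ^ card I * B ^ card J * (\<Prod>m\<in>I. \<Prod>n\<in>J. f (y m / y n))"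

definition subset_sum :: "'a \<Rightarrow> 'a \<Rightarrow> ('i \<Rightarrow> 'a) \<Rightarrow> 'i set \<Rightarrow> 'a" where
  "subset_sum A B y X = (\<Sum>I\<in>Pow X. subset_weight A B y I (X - I))"

lemma subset_weight_insert_right:
  assumes "finite I" "finite J" "n \<notin> J"
  shows "subset_weight A B y I (insert n J) = B * subset_weight A B y I J * (\<Prod>m\<in>I. f (y m / y n))"
  using assms by (simp add: subset_weight_def prod.distrib mult_ac)

lemma subset_weight_insert_left:
  assumes "finite I" "finite J" "n \<notin> I"
  shows "subset_weight A B y (insert n I) J = A * subset_weight A B y I J * (\<Prod>m\<in>J. f (y n / y m))"
  using assms by (simp add: subset_weight_def prod.distrib mult_ac)

text \<open>The poles at \<open>y\<^sub>n\<close> cancel between \<open>I\<close> and \<open>insert n I\<close>; at \<open>\<omega> y\<^sub>n\<close> and \<open>y\<^sub>n / \<omega>\<close> the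
  reflection \<open>f (\<omega> / z) = f z\<close> makes the residue independent of \<open>I\<close> up to the weight.\<close>
lemma residue_sum:
  assumes X: "finite X" and gen: "generic X y"
  shows "(\<Sum>I\<in>Pow X. subset_weight A B y I (X - I) *
      (A * (\<Sum>j\<in>X-I. \<alpha> * y j * (\<Prod>n\<in>X-I-{j}. f (y j / y n)) * \<phi> (y j)
                     + (- \<omega> * \<alpha> * y j) * (\<Prod>n\<in>X-I-{j}. f (\<omega> * y j / y n)) * \<phi> (\<omega> * y j))
     + B * (\<Sum>i\<in>I. (- \<alpha> * y i) * (\<Prod>n\<in>I-{i}. f (y n / y i)) * \<phi> (y i)
                    + (\<alpha> * y i / \<omega>) * (\<Prod>n\<in>I-{i}. f (y n / (y i / \<omega>))) * \<phi> (y i / \<omega>)))) =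
    A * B * (\<Sum>n\<in>X. \<alpha> * y n * subset_sum A B y (X - {n}) *
       ((\<Prod>m\<in>X-{n}. f (y n / y m)) * \<phi> (y n / \<omega>) / \<omega> - \<omega> * (\<Prod>m\<in>X-{n}. f (y m / y n)) * \<phi> (\<omega> * y n)))"
proof -
  define a where "a I j = subset_weight A B y I (X - I) * (A * (\<alpha> * y j * (\<Prod>n\<in>X-I-{j}. f (y j / y n)) * \<phi> (y j)
                     + (- \<omega> * \<alpha> * y j) * (\<Prod>n\<in>X-I-{j}. f (\<omega> * y j / y n)) * \<phi> (\<omega> * y j)))" for I j
  define b where "b I i = subset_weight A B y I (X - I) * (B * ((- \<alpha> * y i) * (\<Prod>n\<in>I-{i}. f (y n / y i)) * \<phi> (y i)
                    + (\<alpha> * y i / \<omega>) * (\<Prod>n\<in>I-{i}. f (y n / (y i / \<omega>))) * \<phi> (y i / \<omega>)))" for I i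
  define c where "c I n = subset_weight A B y I (X - {n} - I) * (A * B * \<alpha> * y n *
       ((\<Prod>m\<in>X-{n}. f (y n / y m)) * \<phi> (y n / \<omega>) / \<omega> - \<omega> * (\<Prod>m\<in>X-{n}. f (y m / y n)) * \<phi> (\<omega> * y n)))" for I n
  have fin: "finite I" if "I \<subseteq> X" for I using that X finite_subset by blast
  have "(\<Sum>I\<in>Pow X. subset_weight A B y I (X - I) *
      (A * (\<Sum>j\<in>X-I. \<alpha> * y j * (\<Prod>n\<in>X-I-{j}. f (y j / y n)) * \<phi> (y j)
                     + (- \<omega> * \<alpha> * y j) * (\<Prod>n\<in>X-I-{j}. f (\<omega> * y j / y n)) * \<phi> (\<omega> * y j))
     + B * (\<Sum>i\<in>I. (- \<alpha> * y i) * (\<Prod>n\<in>I-{i}. f (y n / y i)) * \<phi> (y i)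
                    + (\<alpha> * y i / \<omega>) * (\<Prod>n\<in>I-{i}. f (y n / (y i / \<omega>))) * \<phi> (y i / \<omega>))))
     = (\<Sum>I\<in>Pow X. \<Sum>j\<in>X-I. a I j) + (\<Sum>I\<in>Pow X. \<Sum>i\<in>I. b I i)"
    unfolding sum.distrib[symmetric] a_def b_def
    by (intro sum.cong refl) (simp only: distrib_left sum_distrib_left)
  also have "(\<Sum>I\<in>Pow X. \<Sum>j\<in>X-I. a I j) = (\<Sum>n\<in>X. \<Sum>I\<in>Pow (X-{n}). a I n)"
    by (rule sum_Pow_compl_swap[OF X])
  also have "(\<Sum>I\<in>Pow X. \<Sum>i\<in>I. b I i) = (\<Sum>n\<in>X. \<Sum>I\<in>Pow (X-{n}). b (insert n I) n)"
    by (rule sum_Pow_swap[OF X])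
  also have "(\<Sum>n\<in>X. \<Sum>I\<in>Pow (X-{n}). a I n) + (\<Sum>n\<in>X. \<Sum>I\<in>Pow (X-{n}). b (insert n I) n)
      = (\<Sum>n\<in>X. \<Sum>I\<in>Pow (X-{n}). a I n + b (insert n I) n)"
    by (simp add: sum.distrib)
  also have "\<dots> = (\<Sum>n\<in>X. \<Sum>I\<in>Pow (X-{n}). c I n)"
  proof (intro sum.cong refl)
    fix n I assume n: "n \<in> X" and I: "I \<in> Pow (X - {n})"
    define J where "J = X - {n} - I"
    have IJ: "finite I" "finite J" "n \<notin> I" "n \<notin> J" "I \<inter> J = {}" "X - {n} = I \<union> J"
       "X - I = insert n J" "X - I - {n} = J" "X - insert n I = J" "insert n I - {n} = I"
      using n I X fin[of I] by (auto simp: J_def)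
    \<comment> \<open>In the two contributions below, the terms with \<open>\<phi> (y n)\<close>
      both carry \<open>P I * Q J\<close>, with opposite signs. The others carry
      \<open>P I * P J\<close> and \<open>Q I * Q J\<close>, which are full products over
      \<open>X - {n}\<close> and so no longer depend on \<open>I\<close>.\<close>
    define P where "P S = (\<Prod>m\<in>S. f (y m / y n))" for S
    define Q where "Q S = (\<Prod>m\<in>S. f (y n / y m))" for S
    have PJ: "(\<Prod>m\<in>J. f (\<omega> * y n / y m)) = P J"
      unfolding P_def using n by (intro prod.cong refl f_reflect_ratio[OF gen]) (auto simp: J_def)
    have QI: "(\<Prod>m\<in>I. f (y m / (y n / \<omega>))) = Q I"
      unfolding Q_def
    proof (intro prod.cong refl)
      fix m assume m: "m \<in> I"
      have "f (\<omega> * y m / y n) = f (y n / y m)"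
        using m I n by (intro f_reflect_ratio[OF gen]) auto
      then show "f (y m / (y n / \<omega>)) = f (y n / y m)" by (simp add: mult.commute)
    qed
    have "a I n = B * subset_weight A B y I J * P I * (A * (\<alpha> * y n * Q J * \<phi> (y n) + (- \<omega> * \<alpha> * y n) * P J * \<phi> (\<omega> * y n)))"
      unfolding a_def IJ(8) PJ unfolding IJ(7) using IJ by (simp add: subset_weight_insert_right P_def Q_def)
    moreover have "b (insert n I) n = A * subset_weight A B y I J * Q J *
       (B * ((- \<alpha> * y n) * P I * \<phi> (y n) + (\<alpha> * y n / \<omega>) * Q I * \<phi> (y n / \<omega>)))"
      unfolding b_def IJ(9,10) QI using IJ by (simp add: subset_weight_insert_left P_def Q_def)
    moreover have "c I n = subset_weight A B y I J * (A * B * \<alpha> * y n *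
       ((Q I * Q J) * \<phi> (y n / \<omega>) / \<omega> - \<omega> * (P I * P J) * \<phi> (\<omega> * y n)))"
      unfolding c_def J_def[symmetric] unfolding IJ(6) P_def Q_def using IJ by (simp add: prod.union_disjoint)
    ultimately show "a I n + b (insert n I) n = c I n"
      by (simp only:) (simp add: algebra_simps)
  qed
  also have "\<dots> = A * B * (\<Sum>n\<in>X. \<alpha> * y n * subset_sum A B y (X - {n}) *
       ((\<Prod>m\<in>X-{n}. f (y n / y m)) * \<phi> (y n / \<omega>) / \<omega> - \<omega> * (\<Prod>m\<in>X-{n}. f (y m / y n)) * \<phi> (\<omega> * y n)))"
    unfolding c_def subset_sum_def sum_distrib_left sum_distrib_right
    by (intro sum.cong refl) (simp add: mult_ac)
  finally show ?thesis .
qed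

text \<open>Both parts of \<open>partial_fractions\<close> for the product as a function of
  \<open>t\<close>. The factors \<open>1 / (t - q)\<close> and \<open>1\<close> are kept in the form
  \<open>\<phi> q\<close> so that they match \<open>residue_sum\<close>; likewise in
  \<open>prod_f_left\<close>.\<close>

lemma prod_f_right:
  assumes J: "finite J" and gen: "generic J y"
  shows "(\<And>j. j \<in> J \<Longrightarrow> t \<noteq> y j \<and> t \<noteq> \<omega> * y j) \<Longrightarrow> (\<Prod>j\<in>J. f (t / y j)) =
      1 + (\<Sum>j\<in>J. \<alpha> * y j * (\<Prod>n\<in>J-{j}. f (y j / y n)) * (1 / (t - y j))
                + (- \<omega> * \<alpha> * y j) * (\<Prod>n\<in>J-{j}. f (\<omega> * y j / y n)) * (1 / (t - \<omega> * y j)))"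
    and "(\<Sum>j\<in>J. \<alpha> * y j * (\<Prod>n\<in>J-{j}. f (y j / y n)) * 1
                + (- \<omega> * \<alpha> * y j) * (\<Prod>n\<in>J-{j}. f (\<omega> * y j / y n)) * 1) = \<alpha> * (1 - \<omega>) * sum y J"
proof -
  have g: "f (t / y j) = 1 + \<alpha> * y j / (t - y j) + (- \<omega> * \<alpha> * y j) / (t - \<omega> * y j)"
    if "j \<in> J" "t \<noteq> y j" "t \<noteq> \<omega> * y j" for j t
    using that gen by (intro f_ratio) (auto simp: generic_def)
  have sep: "{y i, \<omega> * y i} \<inter> {y j, \<omega> * y j} = {}" if "i \<in> J" "j \<in> J" "i \<noteq> j" for i j
    using genericD[OF gen that] \<omega>_nz by auto
  note pf = partial_fractions[of J y "\<lambda>j. \<omega> * y j" "\<lambda>j t. f (t / y j)" "\<lambda>j. \<alpha> * y j" "\<lambda>j. - \<omega> * \<alpha> * y j",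
      OF J g sep]
  show "(\<Prod>j\<in>J. f (t / y j)) =
      1 + (\<Sum>j\<in>J. \<alpha> * y j * (\<Prod>n\<in>J-{j}. f (y j / y n)) * (1 / (t - y j))
                + (- \<omega> * \<alpha> * y j) * (\<Prod>n\<in>J-{j}. f (\<omega> * y j / y n)) * (1 / (t - \<omega> * y j)))"
    if "\<And>j. j \<in> J \<Longrightarrow> t \<noteq> y j \<and> t \<noteq> \<omega> * y j"
    using pf(1)[of t] that by simp
  show "(\<Sum>j\<in>J. \<alpha> * y j * (\<Prod>n\<in>J-{j}. f (y j / y n)) * 1
                + (- \<omega> * \<alpha> * y j) * (\<Prod>n\<in>J-{j}. f (\<omega> * y j / y n)) * 1) = \<alpha> * (1 - \<omega>) * sum y J"
    using pf(2) by (simp add: sum_distrib_left algebra_simps sum_subtractf)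
qed

lemma prod_f_left:
  assumes I: "finite I" and gen: "generic I y"
  shows "(\<And>i. i \<in> I \<Longrightarrow> t \<noteq> y i \<and> t \<noteq> y i / \<omega>) \<Longrightarrow> (\<Prod>i\<in>I. f (y i / t)) =
      1 + (\<Sum>i\<in>I. (- \<alpha> * y i) * (\<Prod>n\<in>I-{i}. f (y n / y i)) * (1 / (t - y i))
                + (\<alpha> * y i / \<omega>) * (\<Prod>n\<in>I-{i}. f (y n / (y i / \<omega>))) * (1 / (t - y i / \<omega>)))"
    and "(\<Sum>i\<in>I. (- \<alpha> * y i) * (\<Prod>n\<in>I-{i}. f (y n / y i)) * 1
                + (\<alpha> * y i / \<omega>) * (\<Prod>n\<in>I-{i}. f (y n / (y i / \<omega>))) * 1) = \<alpha> * (1 - \<omega>) / \<omega> * sum y I"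
proof -
  have g: "f (y i / t) = 1 + (- \<alpha> * y i) / (t - y i) + (\<alpha> * y i / \<omega>) / (t - y i / \<omega>)"
    if "i \<in> I" "t \<noteq> y i" "t \<noteq> y i / \<omega>" for i t
    using that gen by (intro f_ratio_inverse) (auto simp: generic_def)
  have sep: "{y i, y i / \<omega>} \<inter> {y j, y j / \<omega>} = {}" if "i \<in> I" "j \<in> I" "i \<noteq> j" for i j
    using genericD[OF gen that] \<omega>_nz by (auto simp: divide_simps mult.commute)
  note pf = partial_fractions[of I y "\<lambda>i. y i / \<omega>" "\<lambda>i t. f (y i / t)" "\<lambda>i. - \<alpha> * y i" "\<lambda>i. \<alpha> * y i / \<omega>",
      OF I g sep]
  show "(\<Prod>i\<in>I. f (y i / t)) =
      1 + (\<Sum>i\<in>I. (- \<alpha> * y i) * (\<Prod>n\<in>I-{i}. f (y n / y i)) * (1 / (t - y i))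
                + (\<alpha> * y i / \<omega>) * (\<Prod>n\<in>I-{i}. f (y n / (y i / \<omega>))) * (1 / (t - y i / \<omega>)))"
    if "\<And>i. i \<in> I \<Longrightarrow> t \<noteq> y i \<and> t \<noteq> y i / \<omega>"
    using pf(1)[of t] that by simp
  have "(\<Sum>i\<in>I. - \<alpha> * y i + \<alpha> * y i / \<omega>) = \<alpha> * (1 - \<omega>) / \<omega> * sum y I"
    using \<omega>_nz unfolding sum_distrib_left by (intro sum.cong refl) (simp add: field_simps)
  then show "(\<Sum>i\<in>I. (- \<alpha> * y i) * (\<Prod>n\<in>I-{i}. f (y n / y i)) * 1
                + (\<alpha> * y i / \<omega>) * (\<Prod>n\<in>I-{i}. f (y n / (y i / \<omega>))) * 1) = \<alpha> * (1 - \<omega>) / \<omega> * sum y I"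
    using pf(2) by simp
qed

text \<open>Expansion in \<open>y x\<close>. Subsets without \<open>x\<close> contribute
  \<open>B\<close> times a product of \<open>f (y i / y x)\<close>, subsets with \<open>x\<close>
  contribute \<open>A\<close> times a product of \<open>f (y x / y j)\<close>. The constant terms
  give \<open>A + B\<close>, the poles are collected by \<open>residue_sum\<close>. Only sums over
  smaller sets remain, with coefficients symmetric in \<open>A\<close> and \<open>B\<close>.\<close>

lemma subset_sum_insert:
  assumes X: "finite X" "x \<notin> X" and gen: "generic (insert x X) y"
  shows "subset_sum A B y (insert x X) = (A + B) * subset_sum A B y X +
    A * B * (\<Sum>n\<in>X. \<alpha> * y n * subset_sum A B y (X - {n}) *
       ((\<Prod>m\<in>X-{n}. f (y n / y m)) * (1 / (y x - y n / \<omega>)) / \<omega>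
         - \<omega> * (\<Prod>m\<in>X-{n}. f (y m / y n)) * (1 / (y x - \<omega> * y n))))"
proof -
  have genX: "generic X y" using gen generic_subset by blast
  have ne: "y x \<noteq> y j" "y x \<noteq> \<omega> * y j" "y x \<noteq> y j / \<omega>" if "j \<in> X" for j
  proof -
    have "x \<noteq> j" using that X by auto
    from genericD[OF gen insertI1 insertI2[OF that] this]
    show "y x \<noteq> y j" "y x \<noteq> \<omega> * y j" "y x \<noteq> y j / \<omega>"
      using \<omega>_nz by (auto simp: divide_simps mult.commute)
  qed
  have "subset_sum A B y (insert x X) = (\<Sum>I\<in>Pow X. subset_weight A B y I (insert x X - I)) + (\<Sum>I\<in>Pow X. subset_weight A B y (insert x I) (insert x X - insert x I))"
  proof -
    have inj: "inj_on (insert x) (Pow X)"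
      using X by (auto simp: inj_on_def insert_ident)
    have disj: "Pow X \<inter> insert x ` Pow X = {}" using X by auto
    show ?thesis
      unfolding subset_sum_def Pow_insert sum.union_disjoint[OF finite_Pow_iff[THEN iffD2, OF X(1)]
          finite_imageI[OF finite_Pow_iff[THEN iffD2, OF X(1)]] disj]
      by (simp add: sum.reindex[OF inj])
  qed
  also have "(\<Sum>I\<in>Pow X. subset_weight A B y I (insert x X - I)) = (\<Sum>I\<in>Pow X. subset_weight A B y I (X - I) * (B * (\<Prod>i\<in>I. f (y i / y x))))"
  proof (intro sum.cong refl)
    fix I assume I: "I \<in> Pow X"
    then have "insert x X - I = insert x (X - I)" using X by auto
    then show "subset_weight A B y I (insert x X - I) = subset_weight A B y I (X - I) * (B * (\<Prod>i\<in>I. f (y i / y x)))"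
      using I X by (simp add: subset_weight_insert_right finite_subset)
  qed
  also have "(\<Sum>I\<in>Pow X. subset_weight A B y (insert x I) (insert x X - insert x I)) = (\<Sum>I\<in>Pow X. subset_weight A B y I (X - I) * (A * (\<Prod>j\<in>X-I. f (y x / y j))))"
  proof (intro sum.cong refl)
    fix I assume I: "I \<in> Pow X"
    then have "insert x X - insert x I = X - I" "finite I" "x \<notin> I" using X finite_subset by auto
    then show "subset_weight A B y (insert x I) (insert x X - insert x I) = subset_weight A B y I (X - I) * (A * (\<Prod>j\<in>X-I. f (y x / y j)))"
      using X by (simp add: subset_weight_insert_left)
  qed
  also have "(\<Sum>I\<in>Pow X. subset_weight A B y I (X - I) * (B * (\<Prod>i\<in>I. f (y i / y x)))) + \<dots> =
     (\<Sum>I\<in>Pow X. (A + B) * subset_weight A B y I (X - I) + subset_weight A B y I (X - I) *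
      (A * (\<Sum>j\<in>X-I. \<alpha> * y j * (\<Prod>n\<in>X-I-{j}. f (y j / y n)) * (1 / (y x - y j))
                     + (- \<omega> * \<alpha> * y j) * (\<Prod>n\<in>X-I-{j}. f (\<omega> * y j / y n)) * (1 / (y x - \<omega> * y j)))
     + B * (\<Sum>i\<in>I. (- \<alpha> * y i) * (\<Prod>n\<in>I-{i}. f (y n / y i)) * (1 / (y x - y i))
                    + (\<alpha> * y i / \<omega>) * (\<Prod>n\<in>I-{i}. f (y n / (y i / \<omega>))) * (1 / (y x - y i / \<omega>)))))"
    unfolding sum.distrib[symmetric]
  proof (intro sum.cong refl)
    fix I assume I: "I \<in> Pow X"
    have r: "(\<Prod>j\<in>X-I. f (y x / y j)) = 1 + (\<Sum>j\<in>X-I. \<alpha> * y j * (\<Prod>n\<in>X-I-{j}. f (y j / y n)) * (1 / (y x - y j))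
                     + (- \<omega> * \<alpha> * y j) * (\<Prod>n\<in>X-I-{j}. f (\<omega> * y j / y n)) * (1 / (y x - \<omega> * y j)))"
      using X ne by (intro prod_f_right generic_subset[OF genX]) auto
    have l: "(\<Prod>i\<in>I. f (y i / y x)) = 1 + (\<Sum>i\<in>I. (- \<alpha> * y i) * (\<Prod>n\<in>I-{i}. f (y n / y i)) * (1 / (y x - y i))
                    + (\<alpha> * y i / \<omega>) * (\<Prod>n\<in>I-{i}. f (y n / (y i / \<omega>))) * (1 / (y x - y i / \<omega>)))"
      using I X ne finite_subset[of I X] by (intro prod_f_left generic_subset[OF genX]) auto
    show "subset_weight A B y I (X - I) * (B * (\<Prod>i\<in>I. f (y i / y x))) + subset_weight A B y I (X - I) * (A * (\<Prod>j\<in>X-I. f (y x / y j))) =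
      (A + B) * subset_weight A B y I (X - I) + subset_weight A B y I (X - I) *
      (A * (\<Sum>j\<in>X-I. \<alpha> * y j * (\<Prod>n\<in>X-I-{j}. f (y j / y n)) * (1 / (y x - y j))
                     + (- \<omega> * \<alpha> * y j) * (\<Prod>n\<in>X-I-{j}. f (\<omega> * y j / y n)) * (1 / (y x - \<omega> * y j)))
     + B * (\<Sum>i\<in>I. (- \<alpha> * y i) * (\<Prod>n\<in>I-{i}. f (y n / y i)) * (1 / (y x - y i))
                    + (\<alpha> * y i / \<omega>) * (\<Prod>n\<in>I-{i}. f (y n / (y i / \<omega>))) * (1 / (y x - y i / \<omega>))))"
      unfolding r l by (simp only: distrib_left distrib_right mult_1_right) (simp only: mult_ac add_ac)
  qed
  also have "\<dots> = (A + B) * subset_sum A B y X + A * B * (\<Sum>n\<in>X. \<alpha> * y n * subset_sum A B y (X - {n}) *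
       ((\<Prod>m\<in>X-{n}. f (y n / y m)) * (1 / (y x - y n / \<omega>)) / \<omega>
         - \<omega> * (\<Prod>m\<in>X-{n}. f (y m / y n)) * (1 / (y x - \<omega> * y n))))"
    by (subst sum.distrib, subst residue_sum[OF X(1) genX, where \<phi> = "\<lambda>q. 1 / (y x - q)"]) (simp add: subset_sum_def sum_distrib_left)
  finally show ?thesis .
qed

text \<open>Induction on the cardinality rather than on the set, since
  \<open>subset_sum_insert\<close> leads to \<open>X'\<close> and to all sets
  \<open>X' - {n}\<close>.\<close>

theorem subset_sum_commute:
  assumes "finite X" "generic X y"
  shows "subset_sum A B y X = subset_sum B A y X"
  using assms
proof (induction "card X" arbitrary: X rule: less_induct)
  case less
  show ?case
  proof (cases "X = {}")
    case True
    then show ?thesis by (simp add: subset_sum_def subset_weight_def)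
  next
    case False
    then obtain x X' where X: "X = insert x X'" "x \<notin> X'" "finite X'"
      using less.prems(1) by (metis Set.set_insert all_not_in_conv finite_insert)
    have IH: "subset_sum A B y Y = subset_sum B A y Y" if "Y \<subseteq> X'" for Y
    proof -
      have "Y \<subset> X" using X that by auto
      then show ?thesis
        using less.prems generic_subset by (intro less.hyps psubset_card_mono) (auto intro: finite_subset)
    qed
    have IHs: "subset_sum A B y (X' - {n}) = subset_sum B A y (X' - {n})" for n by (rule IH) auto
    show ?thesis
      using less.prems X unfolding X(1)
      by (subst (1 2) subset_sum_insert) (simp_all add: IH IHs ac_simps)
  qed
qed

text \<open>\<open>residue_sum\<close> with constant \<open>\<phi>\<close> equal to 1. By the sums
  of residues in \<open>prod_f_right\<close> and \<open>prod_f_left\<close>, one side is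
  \<open>\<alpha> * (1 - \<omega>) / \<omega>\<close> times the weighted sum. The other contains
  \<open>A\<close> and \<open>B\<close> only through \<open>A * B\<close> and
  \<open>subset_sum\<close>, hence is symmetric, and the nonzero factor is cancelled.\<close>

theorem weighted_commute:
  assumes X: "finite X" and gen: "generic X y" and "\<alpha> * (1 - \<omega>) \<noteq> 0"
  shows "(\<Sum>I\<in>Pow X. subset_weight A B y I (X - I) * (B * sum y I + \<omega> * A * sum y (X - I))) =
         (\<Sum>I\<in>Pow X. subset_weight B A y I (X - I) * (A * sum y I + \<omega> * B * sum y (X - I)))"
proof -
  define R where "R A B = A * B * (\<Sum>n\<in>X. \<alpha> * y n * subset_sum A B y (X - {n}) *
       ((\<Prod>m\<in>X-{n}. f (y n / y m)) * 1 / \<omega> - \<omega> * (\<Prod>m\<in>X-{n}. f (y m / y n)) * 1))" for A B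
  have "R A B = (\<Sum>I\<in>Pow X. subset_weight A B y I (X - I) * (A * (\<alpha> * (1 - \<omega>) * sum y (X - I)) + B * (\<alpha> * (1 - \<omega>) / \<omega> * sum y I)))" for A B
    unfolding R_def residue_sum[OF X gen, where \<phi> = "\<lambda>_. 1", symmetric]
  proof (intro sum.cong refl)
    fix I assume I: "I \<in> Pow X"
    then have "finite I" "generic I y" "finite (X - I)" "generic (X - I) y"
      using X finite_subset generic_subset[OF gen] by auto
    note s = prod_f_right(2)[OF this(3,4)] prod_f_left(2)[OF this(1,2)]
    show "subset_weight A B y I (X - I) *
      (A * (\<Sum>j\<in>X-I. \<alpha> * y j * (\<Prod>n\<in>X-I-{j}. f (y j / y n)) * 1
                     + (- \<omega> * \<alpha> * y j) * (\<Prod>n\<in>X-I-{j}. f (\<omega> * y j / y n)) * 1)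
     + B * (\<Sum>i\<in>I. (- \<alpha> * y i) * (\<Prod>n\<in>I-{i}. f (y n / y i)) * 1
                    + (\<alpha> * y i / \<omega>) * (\<Prod>n\<in>I-{i}. f (y n / (y i / \<omega>))) * 1)) =
      subset_weight A B y I (X - I) * (A * (\<alpha> * (1 - \<omega>) * sum y (X - I)) + B * (\<alpha> * (1 - \<omega>) / \<omega> * sum y I))"
      unfolding s ..
  qed
  also have "(\<Sum>I\<in>Pow X. subset_weight A B y I (X - I) * (A * (\<alpha> * (1 - \<omega>) * sum y (X - I)) + B * (\<alpha> * (1 - \<omega>) / \<omega> * sum y I))) =
      \<alpha> * (1 - \<omega>) / \<omega> * (\<Sum>I\<in>Pow X. subset_weight A B y I (X - I) * (B * sum y I + \<omega> * A * sum y (X - I)))" for A B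
  proof -
    have "w * (A * (\<alpha> * (1 - \<omega>) * s) + B * (\<alpha> * (1 - \<omega>) / \<omega> * r)) =
        \<alpha> * (1 - \<omega>) / \<omega> * (w * (B * r + \<omega> * A * s))" for w r s :: 'a
      using \<omega>_nz by (simp add: field_simps)
    then show ?thesis by (simp add: sum_distrib_left[of _ "\<lambda>I. subset_weight A B y I (X - I) * _ I"])
  qed
  finally have R: "R A B = \<alpha> * (1 - \<omega>) / \<omega> * (\<Sum>I\<in>Pow X. subset_weight A B y I (X - I) * (B * sum y I + \<omega> * A * sum y (X - I)))" for A B .
  have "subset_sum A B y (X - {n}) = subset_sum B A y (X - {n})" for n
    using X generic_subset[OF gen] by (intro subset_sum_commute) auto
  then have "R A B = R B A" unfolding R_def by (simp add: mult.commute)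
  then show ?thesis unfolding R using assms(3) \<omega>_nz by simp
qed

end

subsection \<open>Roots of unity and constants\<close>

lemma om_add: "om L (c + d) = om L c * om L d"
  by (simp add: om_def exp_add[symmetric] algebra_simps add_divide_distrib)

lemma om_0 [simp]: "om L 0 = 1"
  by (simp add: om_def)

lemma om_nz [simp]: "om L c \<noteq> 0"
  by (simp add: om_def)

lemma om_minus: "om L (- c) = inverse (om L c)"
  by (simp add: om_def exp_minus)

lemma om_diff: "om L (c - d) = om L c / om L d"
  using om_add[of L c "- d"] by (simp add: om_minus divide_inverse)

lemma om_sum: "finite A \<Longrightarrow> om L (sum f A) = (\<Prod>x\<in>A. om L (f x))"
  by (induction A rule: finite_induct) (simp_all add: om_add)

lemma om_of_nat: "om L (of_nat n) = om L 1 ^ n"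
  by (induction n) (simp_all add: om_add)

lemma om_self: "L > 0 \<Longrightarrow> om L (of_nat L) = 1"
  by (simp add: om_def)

lemma om_real_neq_1:
  assumes "0 < r" "r < real L"
  shows "om L (of_real r) \<noteq> 1"
proof
  assume "om L (of_real r) = 1"
  then obtain n :: int where "2 * pi * r / real L = real_of_int (2 * n) * pi"
    by (auto simp: om_def exp_eq_1)
  then have "r = n * real L" using assms by (simp add: field_simps)
  with assms have "0 < real_of_int n" "real_of_int n < 1"
    by (auto simp: zero_less_mult_iff)
  then show False by simp
qed

lemma mconst_0 [simp]: "mconst 0 = 0"
  by (simp add: mconst_def)

lemma mconst_inject: "mconst c = mconst d \<longleftrightarrow> c = d"
  by (metis mconst_def lookup_single_eq)

lemma rconst_add: "rconst (c + d) = rconst c + rconst d"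
  by (simp add: rconst_def mconst_add to_fract_add)

lemma rconst_mult: "rconst (c * d) = rconst c * rconst d"
  by (simp add: rconst_def mconst_mult to_fract_mult)

lemma rconst_0 [simp]: "rconst 0 = 0"
  by (simp add: rconst_def)

lemma rconst_1 [simp]: "rconst 1 = 1"
  by (simp add: rconst_def)

lemma rconst_eq_iff: "rconst c = rconst d \<longleftrightarrow> c = d"
  by (simp add: rconst_def mconst_inject to_fract_eq_iff)

lemma rconst_eq_0_iff [simp]: "rconst c = 0 \<longleftrightarrow> c = 0"
  using rconst_eq_iff[of c 0] by simp

lemma rconst_diff: "rconst (c - d) = rconst c - rconst d"
  using rconst_add[of "c - d" d] by simp

lemma rconst_power: "rconst (c ^ n) = rconst c ^ n"
  by (induction n) (simp_all add: rconst_mult)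

text \<open>The residue at z = 1. The one at z = \<omega> is -\<omega> times it, because the two
  zeros of f have product \<omega>.\<close>

definition ff_residue :: "nat \<Rightarrow> real \<Rightarrow> complex" where
  "ff_residue L p = (1 - om L (of_real p)) * (1 - om L (of_real (1 - p))) / (1 - om L 1)"

lemma om_1_neq_1: "L \<ge> 2 \<Longrightarrow> om L 1 \<noteq> 1"
  using om_real_neq_1[of 1 L] by simp

text \<open>With a and b the zeros of f, \<open>a * b = w\<close> makes the numerator and the
  denominator agree at z = 0. Both are monic quadratics, so they differ by a multiple of z, namely
  (1 - a)(1 - b) z.\<close>

lemma ff_ruijsenaars:
  assumes "L \<ge> 2"
  shows "ruijsenaars (ff L p) (rconst (ff_residue L p)) (rconst (om L 1))"
proof
  show "rconst (om L 1) \<noteq> 0" by simp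
next
  fix z assume z: "z \<noteq> 1" "z \<noteq> rconst (om L 1)"
  define a b w where "a = om L (of_real p)" and "b = om L (of_real (1 - p))" and "w = om L 1"
  have ab: "a * b = w"
    unfolding a_def b_def w_def by (simp flip: om_add)
  have w1: "w \<noteq> 1" using om_1_neq_1[OF assms] by (simp add: w_def)
  define al where "al = rconst (ff_residue L p)"
  have al: "al * (1 - rconst w) = (1 - rconst a) * (1 - rconst b)"
    unfolding al_def ff_residue_def a_def[symmetric] b_def[symmetric] w_def[symmetric]
    using w1 by (simp flip: rconst_1 rconst_diff rconst_mult)
  have z': "z - 1 \<noteq> 0" "z - rconst w \<noteq> 0" using z by (auto simp: w_def)
  have "(z - rconst a) * (z - rconst b) = (z - 1) * (z - rconst w) + al * (1 - rconst w) * z"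
    unfolding al using arg_cong[OF ab, of rconst] by (simp add: rconst_mult algebra_simps)
  also have "\<dots> = (1 + al / (z - 1) - rconst w * al / (z - rconst w)) * ((z - 1) * (z - rconst w))"
  proof -
    have "al / (z - 1) * ((z - 1) * (z - rconst w)) = al * (z - rconst w)"
      "rconst w * al / (z - rconst w) * ((z - 1) * (z - rconst w)) = rconst w * al * (z - 1)"
      using z' by auto
    then show ?thesis by (simp only: left_diff_distrib distrib_right) (simp add: algebra_simps)
  qed
  finally show "ff L p z = 1 + rconst (ff_residue L p) / (z - 1) - rconst (om L 1) * rconst (ff_residue L p) / (z - rconst (om L 1))"
    unfolding ff_def a_def[symmetric] b_def[symmetric] w_def[symmetric] al_def[symmetric]
    using z' by (simp add: divide_eq_eq)
qed

text \<open>Both \<open>p\<close> and \<open>1 - p\<close> lie strictly between 0 and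
  \<open>L\<close>, so neither zero of f is 1.\<close>

lemma ff_residue_nz:
  assumes "L \<ge> 2" "0 < p" "p < 1"
  shows "rconst (ff_residue L p) * (1 - rconst (om L 1)) \<noteq> 0"
proof -
  have "om L (of_real p) \<noteq> 1" "om L (of_real (1 - p)) \<noteq> 1"
    using om_real_neq_1[of p L] om_real_neq_1[of "1 - p" L] assms by simp_all
  then show ?thesis
    using om_1_neq_1[OF assms(1)] by (simp add: ff_residue_def rconst_eq_iff flip: rconst_1 rconst_diff)
qed

subsection \<open>Positions in a finite set\<close>

text \<open>Inverse to \<open>elt S\<close> on \<open>S\<close>. For \<open>s\<close> outside
  \<open>S\<close> it still counts the elements below \<open>s\<close>, which is the exponent needed
  for the coefficients of \<open>h1\<close>.\<close>

definition pos :: "nat set \<Rightarrow> nat \<Rightarrow> nat" where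
  "pos S s = card {t\<in>S. t \<le> s}"

lemma elt_pos:
  assumes "finite S"
  shows "j \<in> {1..card S} \<Longrightarrow> elt S j \<in> S \<and> pos S (elt S j) = j"
    and "s \<in> S \<Longrightarrow> pos S s \<in> {1..card S} \<and> elt S (pos S s) = s"
proof -
  let ?xs = "sorted_list_of_set S"
  have set: "set ?xs = S" and len: "length ?xs = card S" and srt: "sorted_wrt (<) ?xs"
    using assms by auto
  have 1: "elt S j \<in> S \<and> pos S (elt S j) = j" if j: "j \<in> {1..card S}" for j
  proof -
    have "{t\<in>S. t \<le> ?xs ! (j - 1)} = (!) ?xs ` {..<j}"
    proof (intro equalityI subsetI)
      fix t assume t: "t \<in> {t\<in>S. t \<le> ?xs ! (j - 1)}"
      then obtain i where i: "i < length ?xs" "t = ?xs ! i" using set by (metis CollectD in_set_conv_nth)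
      have "i < j"
      proof (rule ccontr)
        assume "\<not> i < j"
        then have "?xs ! (j - 1) < ?xs ! i" using i j len by (intro sorted_wrt_nth_less[OF srt]) auto
        then show False using t i by simp
      qed
      then show "t \<in> (!) ?xs ` {..<j}" using i by auto
    next
      fix t assume "t \<in> (!) ?xs ` {..<j}"
      then obtain i where i: "i < j" "t = ?xs ! i" by auto
      then have "?xs ! i \<le> ?xs ! (j - 1)" using j len
        by (intro sorted_nth_mono) auto
      moreover have "?xs ! i \<in> S" using i j len set nth_mem[of i ?xs] by auto
      ultimately show "t \<in> {t\<in>S. t \<le> ?xs ! (j - 1)}" using i by simp
    qed
    moreover have "inj_on ((!) ?xs) {..<j}"
      using j len by (intro inj_on_nth) auto
    ultimately have "pos S (elt S j) = j" by (simp add: pos_def elt_def card_image)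
    moreover have "?xs ! (j - 1) \<in> set ?xs" using j len by (intro nth_mem) auto
    then have "elt S j \<in> S" unfolding elt_def set .
    ultimately show ?thesis by simp
  qed
  then show "j \<in> {1..card S} \<Longrightarrow> elt S j \<in> S \<and> pos S (elt S j) = j" .
  show "pos S s \<in> {1..card S} \<and> elt S (pos S s) = s" if s: "s \<in> S"
  proof -
    obtain i where i: "i < card S" "s = ?xs ! i" using s set len by (metis in_set_conv_nth)
    then have "s = elt S (Suc i)" "Suc i \<in> {1..card S}" by (auto simp: elt_def)
    then show ?thesis using 1[of "Suc i"] by simp
  qed
qed

lemma sum_elt:
  assumes "finite S" "card S = l"
  shows "(\<Sum>j=1..l. F j (elt S j)) = (\<Sum>s\<in>S. F (pos S s) s)"
  using elt_pos[OF assms(1)] assms(2)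
  by (intro sum.reindex_bij_witness[where i = "pos S" and j = "elt S"]) auto

lemma prod_elt:
  assumes "finite S" "card S = l"
  shows "(\<Prod>j=1..l. F j (elt S j)) = (\<Prod>s\<in>S. F (pos S s) s)"
  using elt_pos[OF assms(1)] assms(2)
  by (intro prod.reindex_bij_witness[where i = "pos S" and j = "elt S"]) auto

text \<open>Turns the condition s_m > i in \<open>h1\<close> into a lower bound for
  \<open>m\<close>, so that for fixed \<open>S\<close> the sum over \<open>m\<close> becomes
  geometric.\<close>

lemma less_elt_iff:
  assumes "finite S" "m \<in> {1..card S}"
  shows "i < elt S m \<longleftrightarrow> pos S i < m"
proof -
  have e: "elt S m \<in> S" "pos S (elt S m) = m" using elt_pos(1)[OF assms] by auto
  show ?thesis
  proof
    assume "i < elt S m"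
    then have "elt S m \<in> {t\<in>S. t \<le> elt S m}" "elt S m \<notin> {t\<in>S. t \<le> i}"
      "{t\<in>S. t \<le> i} \<subseteq> {t\<in>S. t \<le> elt S m}" using e(1) by auto
    then have "{t\<in>S. t \<le> i} \<subset> {t\<in>S. t \<le> elt S m}" by blast
    then have "pos S i < pos S (elt S m)" using assms(1) unfolding pos_def by (intro psubset_card_mono) auto
    then show "pos S i < m" using e by simp
  next
    assume *: "pos S i < m"
    show "i < elt S m"
    proof (rule ccontr)
      assume "\<not> i < elt S m"
      then have "{t\<in>S. t \<le> elt S m} \<subseteq> {t\<in>S. t \<le> i}" by auto
      then have "pos S (elt S m) \<le> pos S i" using assms(1) unfolding pos_def by (intro card_mono) auto
      then show False using * e by simp
    qed
  qed
qed

subsection \<open>The sum over tuples in terms of positions\<close>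

text \<open>The variable y_j of component \<open>n\<close>, labelled by the element \<open>s\<close>
  at position j instead of by j.\<close>

definition y_at :: "nat \<Rightarrow> (nat \<Rightarrow> nat) \<Rightarrow> nat \<Rightarrow> nat set \<Rightarrow> nat \<Rightarrow> rfun" where
  "y_at L k n S s = to_fract (yy L k n (pos S s))"

definition pair_factor :: "nat \<Rightarrow> real \<Rightarrow> rfun \<Rightarrow> rfun \<Rightarrow> nat \<Rightarrow> nat \<Rightarrow> rfun" where
  "pair_factor L p u v s s' = (if s < s' then ff L p (u / v) else if s' < s then ff L p (v / u) else 1)"

lemma Phi_eq:
  assumes "\<And>n. n \<in> {1..N} \<Longrightarrow> finite (S n) \<and> card (S n) = k n"
  shows "Phi L p k N S = (\<Prod>n=1..N. \<Prod>m\<in>{1..<n}. \<Prod>s\<in>S m. \<Prod>s'\<in>S n.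
     pair_factor L p (y_at L k m (S m) s) (y_at L k n (S n) s') s s')"
  unfolding Phi_def
proof (intro prod.cong[OF refl])
  fix n m assume "n \<in> {1..N}" "m \<in> {1..<n}"
  then have n: "finite (S n)" "card (S n) = k n" and m: "finite (S m)" "card (S m) = k m"
    using assms by auto
  show "(\<Prod>j=1..k m. \<Prod>j'=1..k n.
       let s = elt (S m) j; s' = elt (S n) j';
           u = to_fract (yy L k m j); v = to_fract (yy L k n j')
       in if s < s' then ff L p (u / v) else if s' < s then ff L p (v / u) else 1)
    = (\<Prod>s\<in>S m. \<Prod>s'\<in>S n. pair_factor L p (y_at L k m (S m) s) (y_at L k n (S n) s') s s')"
    (is "?l = ?r")
  proof -
    have "?l = (\<Prod>j=1..k m. \<Prod>j'=1..k n.
        pair_factor L p (to_fract (yy L k m j)) (to_fract (yy L k n j')) (elt (S m) j) (elt (S n) j'))"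
      by (simp only: Let_def pair_factor_def)
    also have "\<dots> = (\<Prod>j=1..k m. \<Prod>s'\<in>S n.
        pair_factor L p (to_fract (yy L k m j)) (y_at L k n (S n) s') (elt (S m) j) s')"
      unfolding y_at_def
      by (intro prod.cong[OF refl] prod_elt[OF n, where F = "\<lambda>j' s'. pair_factor L p _ (to_fract (yy L k n j')) _ s'"])
    also have "\<dots> = ?r"
      unfolding y_at_def[of L k m]
      by (rule prod_elt[OF m, where F = "\<lambda>j s. \<Prod>s'\<in>S n. pair_factor L p (to_fract (yy L k m j)) (y_at L k n (S n) s') s s'"])
    finally show ?thesis .
  qed
qed

text \<open>The part -1/L of \<open>Hw\<close> pairs to 0 with \<open>a\<close>, because the
  coordinates of \<open>a\<close> sum to 0.\<close>

lemma pair_HS: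
  assumes "a \<in> hdual L" "S \<subseteq> {1..L}"
  shows "pair L a (HS L S) = sum a S"
proof -
  have Hw: "pair L a (Hw L s) = a s" if "s \<in> {1..L}" for s
  proof -
    have "pair L a (Hw L s) = (\<Sum>t=1..L. (if t = s then a s else 0) - a t / of_nat L)"
      unfolding pair_def by (intro sum.cong refl) (auto simp: Hw_def algebra_simps)
    also have "\<dots> = a s - (\<Sum>t=1..L. a t) / of_nat L"
      using that by (simp add: sum_subtractf sum_divide_distrib)
    finally show ?thesis using assms(1) by (simp add: hdual_def)
  qed
  have "pair L a (HS L S) = (\<Sum>s\<in>S. pair L a (Hw L s))"
    unfolding pair_def HS_def sum_distrib_left by (rule sum.swap)
  also have "\<dots> = sum a S" using assms(2) by (intro sum.cong refl Hw) auto
  finally show ?thesis .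
qed

lemma om_pair_HS:
  assumes "a \<in> hdual L" "S \<subseteq> {1..L}"
  shows "om L (pair L a (HS L S)) = (\<Prod>s\<in>S. om L (a s))"
  using assms by (simp add: pair_HS om_sum finite_subset)

lemma pair_sum_right: "pair L a (\<lambda>t. \<Sum>n\<in>A. f n t) = (\<Sum>n\<in>A. pair L a (f n))"
  unfolding pair_def sum_distrib_left by (rule sum.swap)

definition linear_elt :: "nat \<Rightarrow> (nat \<Rightarrow> complex) \<Rightarrow> hpoly" where
  "linear_elt L \<eta> = (\<Sum>i=1..L-1. mconst (\<eta> i) * gen i 1)"

text \<open>The coefficient of y at an element \<open>s\<close> in the image of
  \<open>linear_elt L \<eta>\<close>. As \<langle>\<alpha>_i, H_s\<rangle> is nonzero only for i = s
  and i = s - 1, it is a difference of neighbouring \<eta>; the guards replace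
  \<open>\<eta> 0\<close> and \<open>\<eta> L\<close>, which belong to no generator, by 0.\<close>

definition y_coeff :: "nat \<Rightarrow> (nat \<Rightarrow> complex) \<Rightarrow> nat \<Rightarrow> complex" where
  "y_coeff L \<eta> s = om L (- ((of_nat L + 1 - 2 * of_nat s) / 2)) *
     ((if s \<le> L - 1 then \<eta> s else 0) - (if 2 \<le> s then \<eta> (s - 1) else 0))"

lemma msubst_sum: "msubst \<phi> (sum h A) = (\<Sum>x\<in>A. msubst \<phi> (h x))"
  by (induction A rule: infinite_finite_induct) (simp_all add: msubst_0 msubst_add)

lemma mconst_sum: "mconst (sum f A) = (\<Sum>x\<in>A. mconst (f x))"
  by (induction A rule: infinite_finite_induct) (simp_all add: mconst_add)

lemma EE_linear_elt:
  assumes L: "L \<ge> 2" and S: "\<And>n. n \<in> {1..N} \<Longrightarrow> S n \<subseteq> {1..L} \<and> card (S n) = k n"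
  shows "to_fract (EE L k N S (linear_elt L \<eta>)) = (\<Sum>n=1..N. \<Sum>s\<in>S n. rconst (y_coeff L \<eta> s) * y_at L k n (S n) s)"
proof -
  have lc: "(\<Sum>i=1..L-1. \<eta> i * (pair L (sroot i) (Hw L s) * om L (- ((of_nat L + 1 - 2 * of_nat s) / 2) * 1)))
      = y_coeff L \<eta> s" if s: "s \<in> {1..L}" for s
  proof -
    have "(\<Sum>i=1..L-1. \<eta> i * pair L (sroot i) (Hw L s)) =
        (\<Sum>i=1..L-1. (if i = s then \<eta> s else 0) - (if i = s - 1 then \<eta> (s - 1) else 0))"
      using s by (intro sum.cong refl) (auto simp: pair_sroot_Hw)
    also have "\<dots> = (if s \<le> L - 1 then \<eta> s else 0) - (if 2 \<le> s then \<eta> (s - 1) else 0)"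
      using s by (auto simp: sum_subtractf)
    finally show ?thesis
      by (simp add: y_coeff_def sum_distrib_left[symmetric] sum_distrib_right[symmetric] mult.assoc[symmetric] mult.commute)
  qed
  have "EE L k N S (linear_elt L \<eta>) = (\<Sum>i=1..L-1. \<Sum>n=1..N. \<Sum>j=1..k n.
      mconst (\<eta> i * (pair L (sroot i) (Hw L (elt (S n) j)) *
       om L (- ((of_nat L + 1 - 2 * of_nat (elt (S n) j)) / 2) * 1))) * yy L k n j)"
    unfolding EE_def linear_elt_def msubst_sum msubst_mult gen_def
    by (simp add: sum_distrib_left mconst_mult mult.assoc)
  also have "\<dots> = (\<Sum>n=1..N. \<Sum>j=1..k n. \<Sum>i=1..L-1.
      mconst (\<eta> i * (pair L (sroot i) (Hw L (elt (S n) j)) *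
       om L (- ((of_nat L + 1 - 2 * of_nat (elt (S n) j)) / 2) * 1))) * yy L k n j)"
    by (subst sum.swap, intro sum.cong[OF refl], subst sum.swap) simp
  also have "\<dots> = (\<Sum>n=1..N. \<Sum>j=1..k n. mconst (y_coeff L \<eta> (elt (S n) j)) * yy L k n j)"
  proof (intro sum.cong[OF refl])
    fix n j assume n: "n \<in> {1..N}" and j: "j \<in> {1..k n}"
    have "elt (S n) j \<in> {1..L}"
      using S[OF n] j elt_pos(1)[of "S n" j] finite_subset[of "S n" "{1..L}"] by auto
    from lc[OF this] show "(\<Sum>i=1..L-1.
      mconst (\<eta> i * (pair L (sroot i) (Hw L (elt (S n) j)) *
       om L (- ((of_nat L + 1 - 2 * of_nat (elt (S n) j)) / 2) * 1))) * yy L k n j) =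
       mconst (y_coeff L \<eta> (elt (S n) j)) * yy L k n j"
      by (simp only: sum_distrib_right[symmetric] mconst_sum[symmetric])
  qed
  also have "\<dots> = (\<Sum>n=1..N. \<Sum>s\<in>S n. mconst (y_coeff L \<eta> s) * yy L k n (pos (S n) s))"
  proof (rule sum.cong[OF refl])
    fix n assume "n \<in> {1..N}"
    with S have "finite (S n)" "card (S n) = k n" using finite_subset[of "S n" "{1..L}"] by auto
    then show "(\<Sum>j=1..k n. mconst (y_coeff L \<eta> (elt (S n) j)) * yy L k n j) =
       (\<Sum>s\<in>S n. mconst (y_coeff L \<eta> s) * yy L k n (pos (S n) s))"
      by (rule sum_elt[where F = "\<lambda>j s. mconst (y_coeff L \<eta> s) * yy L k n j"])
  qed
  finally show ?thesis
    by (simp add: to_fract_sum to_fract_mult rconst_def y_at_def)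
qed

subsection \<open>Moving \<open>i\<close> to \<open>i + 1\<close> in some components of a tuple\<close>

definition shift :: "nat \<Rightarrow> nat \<Rightarrow> nat" where
  "shift i s = (if s = i then Suc i else s)"

lemma shift_image: "i \<in> S \<Longrightarrow> shift i ` S = insert (Suc i) (S - {i})"
  by (auto simp: shift_def)

lemma inj_on_shift: "Suc i \<notin> S \<Longrightarrow> inj_on (shift i) S"
  by (auto simp: inj_on_def shift_def)

lemma shift_le_iff: "s \<noteq> Suc i \<Longrightarrow> t \<noteq> Suc i \<Longrightarrow> shift i s \<le> shift i t \<longleftrightarrow> s \<le> t"
  by (auto simp: shift_def)

text \<open>Without \<open>Suc i\<close> in \<open>S\<close> the shift preserves the order on
  \<open>S\<close>. Hence moving \<open>i\<close> to \<open>Suc i\<close> changes no position, and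
  by \<open>y_at_shift\<close> no y.\<close>

lemma pos_shift:
  assumes "Suc i \<notin> S" "s \<in> S"
  shows "pos (shift i ` S) (shift i s) = pos S s"
proof -
  have "shift i t \<le> shift i s \<longleftrightarrow> t \<le> s" if "t \<in> S" for t
    using that assms by (intro shift_le_iff) auto
  then have "{t \<in> shift i ` S. t \<le> shift i s} = shift i ` {t \<in> S. t \<le> s}"
    by auto
  moreover have "inj_on (shift i) {t \<in> S. t \<le> s}"
    using assms by (intro inj_on_shift) auto
  ultimately show ?thesis by (simp add: pos_def card_image)
qed

lemma y_at_shift:
  "Suc i \<notin> S \<Longrightarrow> s \<in> S \<Longrightarrow> y_at L k n (shift i ` S) (shift i s) = y_at L k n S s"
  by (simp add: y_at_def pos_shift)

lemma pos_Suc: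
  assumes "finite S" "Suc i \<in> S"
  shows "pos S (Suc i) = Suc (pos S i)"
proof -
  have "{t \<in> S. t \<le> Suc i} = insert (Suc i) {t \<in> S. t \<le> i}" using assms by auto
  then show ?thesis using assms by (simp add: pos_def)
qed

lemma yy_eq: "yy L k n j = Poly_Mapping.single (Poly_Mapping.single n 1) (om L ((of_nat (k n) + 1 - 2 * of_nat j) / 2))"
  by (simp add: yy_def mvar_def mconst_def mult_single)

lemma y_at_nz: "y_at L k n S s \<noteq> 0"
proof -
  have "yy L k n j \<noteq> 0" for j
    unfolding yy_eq by (metis lookup_single_eq lookup_zero om_nz)
  then show ?thesis by (simp add: y_at_def)
qed

text \<open>The y of different components are nonzero multiples of different variables; compare the
  coefficients of the monomial of \<open>m\<close>. This yields genericity.\<close>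

lemma y_at_neq:
  assumes "m \<noteq> n"
  shows "y_at L k m S s \<noteq> rconst c * y_at L k n T t"
proof
  assume eq: "y_at L k m S s = rconst c * y_at L k n T t"
  have "Poly_Mapping.single m (1::nat) \<noteq> Poly_Mapping.single n 1"
    using assms by (metis lookup_single_eq lookup_single_not_eq zero_neq_one)
  then have "poly_mapping.lookup (mconst c * yy L k n j) (Poly_Mapping.single m 1) = 0" for j
    by (simp add: yy_eq mconst_def mult_single lookup_single_not_eq)
  moreover have "yy L k m (pos S s) = mconst c * yy L k n (pos T t)"
    using eq by (simp only: y_at_def rconst_def to_fract_mult[symmetric] to_fract_eq_iff)
  ultimately have "poly_mapping.lookup (yy L k m (pos S s)) (Poly_Mapping.single m 1) = 0" by simp
  then show False by (simp add: yy_eq)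
qed

text \<open>Consecutive positions differ by a factor \<omega>. This is what lets the reflection of f
  act on components containing both \<open>i\<close> and \<open>Suc i\<close>.\<close>

lemma y_at_Suc:
  assumes "finite S" "Suc i \<in> S"
  shows "y_at L k n S i = rconst (om L 1) * y_at L k n S (Suc i)"
proof -
  have e: "(of_nat (k n) + 1 - 2 * of_nat (pos S i)) / 2 =
      1 + (of_nat (k n) + 1 - 2 * of_nat (Suc (pos S i))) / (2::complex)"
    by (simp add: field_simps)
  have "om L ((of_nat (k n) + 1 - 2 * of_nat (pos S i)) / 2) =
      om L 1 * om L ((of_nat (k n) + 1 - 2 * of_nat (pos S (Suc i))) / 2)"
    unfolding pos_Suc[OF assms] e by (rule om_add)
  then have "yy L k n (pos S i) = mconst (om L 1) * yy L k n (pos S (Suc i))"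
    by (simp only: yy_def mconst_mult mult.left_commute)
  then show ?thesis by (simp only: y_at_def rconst_def to_fract_mult[symmetric])
qed

lemma pair_factor_swap: "pair_factor L p u v s s' = pair_factor L p v u s' s"
  by (simp add: pair_factor_def)

text \<open>Elements of \<open>Q\<close> other than \<open>i\<close> and \<open>Suc i\<close>
  compare alike with both. If \<open>Q\<close> has \<open>i\<close> alone, the trivial factor of the
  equal pair becomes \<open>ff L p (v i / u i)\<close>. If it has both, the factor moves from the
  pair with \<open>Suc i\<close> to the pair with \<open>i\<close>, and \<open>both\<close> says
  that its value is unchanged.\<close>

lemma pair_factor_shift_prod:
  assumes fin: "finite P" "finite Q" and P: "i \<in> P" "Suc i \<notin> P"
    and Q: "Suc i \<in> Q \<Longrightarrow> i \<in> Q" and both: "Suc i \<in> Q \<Longrightarrow> ff L p (v i / u i) = ff L p (u i / v (Suc i))"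
  shows "(\<Prod>s\<in>P. \<Prod>s'\<in>Q. pair_factor L p (u s) (v s') (shift i s) s') =
     (\<Prod>s\<in>P. \<Prod>s'\<in>Q. pair_factor L p (u s) (v s') s s') * (if i \<in> Q \<and> Suc i \<notin> Q then ff L p (v i / u i) else 1)"
proof -
  have "(\<Prod>s'\<in>Q. pair_factor L p (u i) (v s') (Suc i) s') =
     (\<Prod>s'\<in>Q. pair_factor L p (u i) (v s') i s') * (if i \<in> Q \<and> Suc i \<notin> Q then ff L p (v i / u i) else 1)"
  proof -
    define Q' where "Q' = Q - {i, Suc i}"
    have Q': "finite Q'" "i \<notin> Q'" "Suc i \<notin> Q'" using fin by (auto simp: Q'_def)
    have eq: "(\<Prod>s'\<in>Q'. pair_factor L p (u i) (v s') (Suc i) s') = (\<Prod>s'\<in>Q'. pair_factor L p (u i) (v s') i s')"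
      by (intro prod.cong refl) (auto simp: Q'_def pair_factor_def)
    have k: "pair_factor L p (u i) (v i) (Suc i) i = ff L p (v i / u i)" "pair_factor L p (u i) (v i) i i = 1"
      "pair_factor L p (u i) (v (Suc i)) (Suc i) (Suc i) = 1" "pair_factor L p (u i) (v (Suc i)) i (Suc i) = ff L p (u i / v (Suc i))"
      by (simp_all add: pair_factor_def)
    consider "Q = Q'" "i \<notin> Q" | "Q = insert i Q'" "Suc i \<notin> Q" | "Q = insert i (insert (Suc i) Q')" "Suc i \<in> Q"
      using Q by (cases "Suc i \<in> Q"; cases "i \<in> Q") (auto simp: Q'_def)
    then show ?thesis
    proof cases
      case 1
      then show ?thesis using eq by simp
    next
      case 2
      then have "(\<Prod>s'\<in>Q. F s') = F i * (\<Prod>s'\<in>Q'. F s')" for F :: "nat \<Rightarrow> rfun"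
        using Q' by simp
      then show ?thesis using 2 by (simp only: eq k) simp
    next
      case 3
      then have "(\<Prod>s'\<in>Q. F s') = F i * (F (Suc i) * (\<Prod>s'\<in>Q'. F s'))" for F :: "nat \<Rightarrow> rfun"
        using Q' by simp
      then show ?thesis using 3 both by (simp only: eq k) simp
    qed
  qed
  moreover have "(\<Prod>s\<in>P-{i}. \<Prod>s'\<in>Q. pair_factor L p (u s) (v s') (shift i s) s') = (\<Prod>s\<in>P-{i}. \<Prod>s'\<in>Q. pair_factor L p (u s) (v s') s s')"
    by (intro prod.cong refl) (auto simp: shift_def)
  ultimately show ?thesis
    using fin P by (simp add: prod.remove[of P i] shift_def)
qed

lemma pair_factor_shift_both:
  assumes "Suc i \<notin> P" "Suc i \<notin> Q" "s \<in> P" "s' \<in> Q"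
  shows "pair_factor L p u v (shift i s) (shift i s') = pair_factor L p u v s s'"
proof -
  have "s \<noteq> Suc i" "s' \<noteq> Suc i" using assms by auto
  then show ?thesis by (simp add: pair_factor_def shift_le_iff flip: not_le)
qed

text \<open>\<open>Phi\<close> runs over unordered pairs of components, whereas the factors gained
  by shifting belong to ordered pairs.\<close>

lemma prod_unordered_pairs:
  fixes r :: "nat \<Rightarrow> nat \<Rightarrow> 'a::comm_monoid_mult"
  assumes "\<And>n. r n n = 1"
  shows "(\<Prod>n=1..N. \<Prod>m\<in>{1..<n}. r m n * r n m) = (\<Prod>m=1..N. \<Prod>n=1..N. r m n)"
proof (induction N)
  case (Suc N)
  have "{1..<Suc N} = {1..N}" by auto
  then show ?case using Suc by (simp add: prod.distrib assms mult_ac)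
qed simp

section \<open>Grouping the tuples by the components with exactly one of \<open>i\<close>,
  \<open>Suc i\<close>\<close>

locale swap_setup =
  fixes L N i :: nat and p :: real and k :: "nat \<Rightarrow> nat"
  assumes L: "L \<ge> 2" and p: "0 < p" "p < 1" and i: "i \<in> {1..L-1}"
begin

sublocale R: ruijsenaars "ff L p" "rconst (ff_residue L p)" "rconst (om L 1)"
  by (rule ff_ruijsenaars[OF L])

text \<open>For a tuple in \<open>low_tuples\<close> this is the set X of the overview; for an
  arbitrary tuple it is the set I.\<close>

definition lone :: "(nat \<Rightarrow> nat set) \<Rightarrow> nat set" where
  "lone S = {n\<in>{1..N}. i \<in> S n \<and> Suc i \<notin> S n}"

text \<open>One representative per group: the tuple in which every component with exactly one of
  \<open>i\<close>, \<open>Suc i\<close> contains \<open>i\<close>.\<close>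

definition low_tuples :: "(nat \<Rightarrow> nat set) set" where
  "low_tuples = {S\<in>tuples L k N. \<forall>n\<in>{1..N}. Suc i \<in> S n \<longrightarrow> i \<in> S n}"

definition shifted :: "(nat \<Rightarrow> nat set) \<Rightarrow> nat set \<Rightarrow> nat \<Rightarrow> nat set" where
  "shifted S I n = (if n \<in> lone S - I then insert (Suc i) (S n - {i}) else S n)"

text \<open>The representative of the group of \<open>S\<close>. Outside \<open>{1..N}\<close> a
  tuple is \<open>undefined\<close> and has to be left alone, hence the bound on
  \<open>n\<close>.\<close>

definition unshifted :: "(nat \<Rightarrow> nat set) \<Rightarrow> nat \<Rightarrow> nat set" where
  "unshifted S n = (if n \<in> {1..N} \<and> i \<notin> S n \<and> Suc i \<in> S n then insert i (S n - {Suc i}) else S n)"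

lemma tuplesD:
  assumes "S \<in> tuples L k N" "n \<in> {1..N}"
  shows "S n \<subseteq> {1..L}" "card (S n) = k n" "finite (S n)"
  using assms finite_subset[of "S n" "{1..L}"] by (auto simp: tuples_def PiE_def Pi_def)

lemma tuplesI:
  assumes "S \<in> tuples L k N" "\<And>n. n \<notin> {1..N} \<Longrightarrow> S' n = S n"
    and "\<And>n. n \<in> {1..N} \<Longrightarrow> S' n \<subseteq> {1..L} \<and> card (S' n) = k n"
  shows "S' \<in> tuples L k N"
  using assms by (auto simp: tuples_def PiE_def Pi_def extensional_def)

lemma card_exchange: "finite A \<Longrightarrow> x \<in> A \<Longrightarrow> y \<notin> A \<Longrightarrow> card (insert y (A - {x})) = card A"
  by (metis DiffD1 card.remove card_insert_disjoint finite_Diff)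

text \<open>\<open>shifted\<close> is a bijection from pairs of a representative and a subset of its
  \<open>lone\<close> components; its inverse sends \<open>S\<close> to
  \<open>(unshifted S, lone S)\<close>.\<close>

lemma sum_tuples:
  fixes F :: "(nat \<Rightarrow> nat set) \<Rightarrow> 'b::comm_monoid_add"
  shows "(\<Sum>S\<in>tuples L k N. F S) = (\<Sum>S\<in>low_tuples. \<Sum>I\<in>Pow (lone S). F (shifted S I))"
proof -
  have fin: "finite (tuples L k N)"
    unfolding tuples_def by (intro finite_PiE) (auto intro: finite_subset[of _ "Pow {1..L}"])
  have iL: "i \<in> {1..L}" "Suc i \<in> {1..L}" using i by auto
  have "(\<Sum>S\<in>low_tuples. \<Sum>I\<in>Pow (lone S). F (shifted S I)) = (\<Sum>(S, I)\<in>Sigma low_tuples (\<lambda>S. Pow (lone S)). F (shifted S I))"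
    using fin by (intro sum.Sigma) (auto simp: low_tuples_def lone_def)
  also have "\<dots> = (\<Sum>S\<in>tuples L k N. F S)"
  proof (rule sum.reindex_bij_witness[where j = "\<lambda>(S, I). shifted S I" and i = "\<lambda>S. (unshifted S, lone S)"])
    fix S assume S: "S \<in> tuples L k N"
    have c: "unshifted S \<in> tuples L k N"
    proof (rule tuplesI[OF S])
      fix n assume n: "n \<in> {1..N}"
      note d = tuplesD[OF S n]
      show "unshifted S n \<subseteq> {1..L} \<and> card (unshifted S n) = k n"
        using d iL card_exchange[OF d(3), of "Suc i" i] by (auto simp: unshifted_def)
    qed (auto simp: unshifted_def)
    have X: "lone (unshifted S) = {n\<in>{1..N}. (i \<in> S n) \<noteq> (Suc i \<in> S n)}"
      by (auto simp: lone_def unshifted_def)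
    show "(unshifted S, lone S) \<in> Sigma low_tuples (\<lambda>S. Pow (lone S))"
      using c X by (auto simp: low_tuples_def unshifted_def lone_def)
    show "(case (unshifted S, lone S) of (S, I) \<Rightarrow> shifted S I) = S"
    proof -
      have "shifted (unshifted S) (lone S) n = S n" for n
        unfolding shifted_def X by (auto simp: unshifted_def lone_def)
      then show ?thesis by auto
    qed
  next
    fix SI assume "SI \<in> Sigma low_tuples (\<lambda>S. Pow (lone S))"
    then obtain S I where SI: "SI = (S, I)" "S \<in> low_tuples" "I \<subseteq> lone S" by auto
    then have S: "S \<in> tuples L k N" and B: "\<And>n. n \<in> {1..N} \<Longrightarrow> Suc i \<in> S n \<Longrightarrow> i \<in> S n"
      by (auto simp: low_tuples_def)
    have "shifted S I \<in> tuples L k N"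
    proof (rule tuplesI[OF S])
      fix n assume n: "n \<in> {1..N}"
      note d = tuplesD[OF S n]
      show "shifted S I n \<subseteq> {1..L} \<and> card (shifted S I n) = k n"
        using d iL card_exchange[OF d(3), of i "Suc i"] by (auto simp: shifted_def lone_def)
    qed (auto simp: shifted_def lone_def)
    then show "(case SI of (S, I) \<Rightarrow> shifted S I) \<in> tuples L k N" using SI by simp
    have "unshifted (shifted S I) n = S n" for n
      using B[of n] by (auto simp: unshifted_def shifted_def lone_def)
    moreover have "lone (shifted S I) = I"
      using SI(3) by (auto simp: shifted_def lone_def)
    ultimately show "(unshifted (case SI of (S, I) \<Rightarrow> shifted S I), lone (case SI of (S, I) \<Rightarrow> shifted S I)) = SI"
      using SI by auto
  qed auto
  finally show ?thesis ..
qed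

definition shift_at :: "(nat \<Rightarrow> nat set) \<Rightarrow> nat set \<Rightarrow> nat \<Rightarrow> nat \<Rightarrow> nat" where
  "shift_at S I n = (if n \<in> lone S - I then shift i else id)"

definition lone_y :: "(nat \<Rightarrow> nat set) \<Rightarrow> nat \<Rightarrow> rfun" where
  "lone_y S n = y_at L k n (S n) i"

definition cross_factor :: "(nat \<Rightarrow> nat set) \<Rightarrow> nat set \<Rightarrow> nat \<Rightarrow> nat \<Rightarrow> rfun" where
  "cross_factor S I m n = (if m \<in> I \<and> n \<in> lone S - I then ff L p (lone_y S m / lone_y S n) else 1)"

text \<open>For a representative \<open>S\<close>, the part of component \<open>n\<close> shared by
  all members of its group.\<close>

definition rest :: "(nat \<Rightarrow> nat set) \<Rightarrow> nat \<Rightarrow> nat set" where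
  "rest S n = (if n \<in> lone S then S n - {i} else S n)"

lemma low_tuplesD:
  assumes "S \<in> low_tuples" "n \<in> {1..N}"
  shows "S n \<subseteq> {1..L}" "card (S n) = k n" "finite (S n)" "Suc i \<in> S n \<Longrightarrow> i \<in> S n"
  using assms tuplesD[of S n] by (auto simp: low_tuples_def)

context
  fixes S I assumes S: "S \<in> low_tuples" and I: "I \<subseteq> lone S"
begin

lemma shifted_eq: "shifted S I n = shift_at S I n ` S n"
  using shift_image[of i "S n"] by (auto simp: shifted_def shift_at_def lone_def)

lemma inj_shift_at: "inj_on (shift_at S I n) (S n)"
  using inj_on_shift[of i "S n"] by (auto simp: shift_at_def lone_def)

lemma y_at_shift_at: "s \<in> S n \<Longrightarrow> y_at L k n (shifted S I n) (shift_at S I n s) = y_at L k n (S n) s"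
  using y_at_shift[of i "S n" s L k n] unfolding shifted_eq by (auto simp: shift_at_def lone_def)

text \<open>With u the variable of component \<open>m\<close> and v that at \<open>Suc i\<close>,
  the variable at \<open>i\<close> is \<omega> v by \<open>y_at_Suc\<close>, and the claim is the
  reflection at z = u / v.\<close>

lemma ff_both:
  assumes "m \<noteq> n" "n \<in> {1..N}" "Suc i \<in> S n"
  shows "ff L p (y_at L k n (S n) i / y_at L k m T t) = ff L p (y_at L k m T t / y_at L k n (S n) (Suc i))"
proof -
  define u where "u = y_at L k m T t"
  define v where "v = y_at L k n (S n) (Suc i)"
  have nz: "u \<noteq> 0" "v \<noteq> 0" by (simp_all add: u_def v_def y_at_nz)
  have ne: "u \<noteq> rconst c * v" for c using assms(1) y_at_neq unfolding u_def v_def by blast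
  have "u \<noteq> v" using ne[of 1] by simp
  then have "ff L p (rconst (om L 1) / (u / v)) = ff L p (u / v)"
    using nz ne[of "om L 1"] by (intro R.f_reflect) (auto simp: divide_simps)
  moreover have "y_at L k n (S n) i = rconst (om L 1) * v"
    unfolding v_def using assms low_tuplesD[OF S, of n] by (intro y_at_Suc) auto
  ultimately show ?thesis unfolding u_def[symmetric] v_def[symmetric] by simp
qed

text \<open>A factor is gained only if both components are lone and exactly one of them is moved;
  its argument is the y of the component keeping \<open>i\<close> over the y of the moved
  one.\<close>

lemma Phi_factor:
  assumes m: "m \<in> {1..N}" and n: "n \<in> {1..N}" and ne: "m \<noteq> n"
  shows "(\<Prod>s\<in>shifted S I m. \<Prod>s'\<in>shifted S I n. pair_factor L p (y_at L k m (shifted S I m) s) (y_at L k n (shifted S I n) s') s s') =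
    (\<Prod>s\<in>S m. \<Prod>s'\<in>S n. pair_factor L p (y_at L k m (S m) s) (y_at L k n (S n) s') s s') * (cross_factor S I m n * cross_factor S I n m)"
proof -
  let ?u = "y_at L k m (S m)" and ?v = "y_at L k n (S n)"
  have "(\<Prod>s\<in>shifted S I m. \<Prod>s'\<in>shifted S I n. pair_factor L p (y_at L k m (shifted S I m) s) (y_at L k n (shifted S I n) s') s s')
     = (\<Prod>s\<in>S m. \<Prod>s'\<in>S n. pair_factor L p (y_at L k m (shifted S I m) (shift_at S I m s)) (y_at L k n (shifted S I n) (shift_at S I n s')) (shift_at S I m s) (shift_at S I n s'))"
    unfolding shifted_eq by (simp add: prod.reindex[OF inj_shift_at])
  also have "\<dots> = (\<Prod>s\<in>S m. \<Prod>s'\<in>S n. pair_factor L p (?u s) (?v s') (shift_at S I m s) (shift_at S I n s'))"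
    by (intro prod.cong refl) (simp add: y_at_shift_at)
  also have "\<dots> = (\<Prod>s\<in>S m. \<Prod>s'\<in>S n. pair_factor L p (?u s) (?v s') s s') * (cross_factor S I m n * cross_factor S I n m)"
  proof -
    have Xn: "n \<in> lone S \<longleftrightarrow> i \<in> S n \<and> Suc i \<notin> S n" and Xm: "m \<in> lone S \<longleftrightarrow> i \<in> S m \<and> Suc i \<notin> S m"
      using m n by (auto simp: lone_def)
    consider "m \<notin> lone S - I" "n \<notin> lone S - I" | "m \<in> lone S - I" "n \<in> lone S - I"
      | "m \<in> lone S - I" "n \<notin> lone S - I" | "m \<notin> lone S - I" "n \<in> lone S - I" by blast
    then show ?thesis
    proof cases
      case 1
      then show ?thesis by (auto simp: shift_at_def cross_factor_def)
    next
      case 2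
      then have "(\<Prod>s\<in>S m. \<Prod>s'\<in>S n. pair_factor L p (?u s) (?v s') (shift_at S I m s) (shift_at S I n s')) =
         (\<Prod>s\<in>S m. \<Prod>s'\<in>S n. pair_factor L p (?u s) (?v s') s s')"
        using Xn Xm by (intro prod.cong refl) (simp add: shift_at_def pair_factor_shift_both[of i "S m" "S n"])
      then show ?thesis using 2 by (simp add: cross_factor_def)
    next
      case 3
      have "(\<Prod>s\<in>S m. \<Prod>s'\<in>S n. pair_factor L p (?u s) (?v s') (shift i s) s') =
         (\<Prod>s\<in>S m. \<Prod>s'\<in>S n. pair_factor L p (?u s) (?v s') s s') * (if i \<in> S n \<and> Suc i \<notin> S n then ff L p (?v i / ?u i) else 1)"
        using 3 Xm low_tuplesD[OF S m] low_tuplesD[OF S n] ff_both[OF ne n] by (intro pair_factor_shift_prod) auto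
      then show ?thesis using 3 Xn I by (auto simp: cross_factor_def shift_at_def lone_y_def)
    next
      case 4
      \<comment> \<open>The previous case with \<open>m\<close> and \<open>n\<close> exchanged, read
        back through \<open>pair_factor_swap\<close>.\<close>
      have "(\<Prod>s'\<in>S n. \<Prod>s\<in>S m. pair_factor L p (?v s') (?u s) (shift i s') s) =
         (\<Prod>s'\<in>S n. \<Prod>s\<in>S m. pair_factor L p (?v s') (?u s) s' s) * (if i \<in> S m \<and> Suc i \<notin> S m then ff L p (?u i / ?v i) else 1)"
        using 4 Xn low_tuplesD[OF S m] low_tuplesD[OF S n] ff_both[OF ne[symmetric] m] by (intro pair_factor_shift_prod) auto
      then have "(\<Prod>s\<in>S m. \<Prod>s'\<in>S n. pair_factor L p (?u s) (?v s') s (shift i s')) =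
         (\<Prod>s\<in>S m. \<Prod>s'\<in>S n. pair_factor L p (?u s) (?v s') s s') * (if i \<in> S m \<and> Suc i \<notin> S m then ff L p (?u i / ?v i) else 1)"
        unfolding pair_factor_swap[of L p "?v _"] by (subst (1 2) prod.swap)
      then show ?thesis using 4 Xm I by (auto simp: cross_factor_def shift_at_def lone_y_def)
    qed
  qed
  finally show ?thesis .
qed

lemma Phi_shifted: "Phi L p k N (shifted S I) = Phi L p k N S * (\<Prod>m\<in>I. \<Prod>n\<in>lone S - I. ff L p (lone_y S m / lone_y S n))"
proof -
  have c: "card (shifted S I n) = k n" "finite (shifted S I n)" if "n \<in> {1..N}" for n
    using low_tuplesD[OF S that] unfolding shifted_eq by (simp_all add: card_image[OF inj_shift_at])
  have "Phi L p k N (shifted S I) = (\<Prod>n=1..N. \<Prod>m\<in>{1..<n}. \<Prod>s\<in>shifted S I m. \<Prod>s'\<in>shifted S I n.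
     pair_factor L p (y_at L k m (shifted S I m) s) (y_at L k n (shifted S I n) s') s s')"
    using c by (intro Phi_eq) auto
  also have "\<dots> = (\<Prod>n=1..N. \<Prod>m\<in>{1..<n}.
    (\<Prod>s\<in>S m. \<Prod>s'\<in>S n. pair_factor L p (y_at L k m (S m) s) (y_at L k n (S n) s') s s') * (cross_factor S I m n * cross_factor S I n m))"
    by (intro prod.cong[OF refl] Phi_factor) auto
  also have "\<dots> = Phi L p k N S * (\<Prod>n=1..N. \<Prod>m\<in>{1..<n}. cross_factor S I m n * cross_factor S I n m)"
    using low_tuplesD[OF S] by (subst Phi_eq) (auto simp: prod.distrib)
  also have "(\<Prod>n=1..N. \<Prod>m\<in>{1..<n}. cross_factor S I m n * cross_factor S I n m) = (\<Prod>m=1..N. \<Prod>n=1..N. cross_factor S I m n)"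
    by (rule prod_unordered_pairs) (auto simp: cross_factor_def)
  also have "\<dots> = (\<Prod>m\<in>I. \<Prod>n=1..N. cross_factor S I m n)"
    using I by (intro prod.mono_neutral_right) (auto simp: cross_factor_def lone_def)
  also have "\<dots> = (\<Prod>m\<in>I. \<Prod>n\<in>lone S - I. cross_factor S I m n)"
    by (intro prod.cong[OF refl] prod.mono_neutral_right) (auto simp: cross_factor_def lone_def)
  also have "\<dots> = (\<Prod>m\<in>I. \<Prod>n\<in>lone S - I. ff L p (lone_y S m / lone_y S n))"
    by (intro prod.cong[OF refl]) (auto simp: cross_factor_def)
  finally show ?thesis .
qed

text \<open>For \<open>x s = om L (a s)\<close> the split-off powers are the powers of A and B in
  \<open>subset_weight\<close>; \<open>sum_shifted\<close> is the additive analogue for the linear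
  form in the y.\<close>

lemma prod_shifted:
  fixes x :: "nat \<Rightarrow> 'b::comm_monoid_mult"
  shows "(\<Prod>n=1..N. \<Prod>s\<in>shifted S I n. x s) =
     (\<Prod>n=1..N. \<Prod>s\<in>rest S n. x s) * (x i ^ card I * x (Suc i) ^ card (lone S - I))"
proof -
  have fin: "finite (lone S)" by (simp add: lone_def)
  have XN: "lone S \<subseteq> {1..N}" by (auto simp: lone_def)
  have "(\<Prod>n=1..N. \<Prod>s\<in>shifted S I n. x s) = (\<Prod>n=1..N. (\<Prod>s\<in>rest S n. x s) *
      ((if n \<in> I then x i else 1) * (if n \<in> lone S - I then x (Suc i) else 1)))"
  proof (rule prod.cong[OF refl])
    fix n assume n: "n \<in> {1..N}"
    have "(\<Prod>s\<in>shifted S I n. x s) = (\<Prod>s\<in>S n. x (shift_at S I n s))"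
      unfolding shifted_eq by (simp add: prod.reindex[OF inj_shift_at])
    also have "\<dots> = (\<Prod>s\<in>rest S n. x s) *
      ((if n \<in> I then x i else 1) * (if n \<in> lone S - I then x (Suc i) else 1))"
    proof (cases "n \<in> lone S")
      case True
      then have "i \<in> S n" by (simp add: lone_def)
      then have "(\<Prod>s\<in>S n. x (shift_at S I n s)) = x (shift_at S I n i) * (\<Prod>s\<in>S n - {i}. x (shift_at S I n s))"
        using low_tuplesD[OF S n] by (intro prod.remove) auto
      also have "(\<Prod>s\<in>S n - {i}. x (shift_at S I n s)) = (\<Prod>s\<in>S n - {i}. x s)"
        by (intro prod.cong refl) (auto simp: shift_at_def shift_def)
      finally show ?thesis using True by (auto simp: shift_at_def shift_def rest_def mult.commute)
    next
      case False
      then show ?thesis using I by (auto simp: shift_at_def rest_def)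
    qed
    finally show "(\<Prod>s\<in>shifted S I n. x s) = (\<Prod>s\<in>rest S n. x s) *
      ((if n \<in> I then x i else 1) * (if n \<in> lone S - I then x (Suc i) else 1))" .
  qed
  also have "\<dots> = (\<Prod>n=1..N. \<Prod>s\<in>rest S n. x s) * ((\<Prod>n=1..N. if n \<in> I then x i else 1) *
      (\<Prod>n=1..N. if n \<in> lone S - I then x (Suc i) else 1))"
    by (simp add: prod.distrib)
  also have "(\<Prod>n=1..N. if n \<in> I then x i else 1) = (\<Prod>n\<in>I. if n \<in> I then x i else 1)"
    using I XN by (intro prod.mono_neutral_right) auto
  also have "(\<Prod>n=1..N. if n \<in> lone S - I then x (Suc i) else 1) = (\<Prod>n\<in>lone S - I. if n \<in> lone S - I then x (Suc i) else 1)"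
    using XN by (intro prod.mono_neutral_right) auto
  finally show ?thesis by simp
qed

lemma sum_shifted:
  "(\<Sum>n=1..N. \<Sum>s\<in>shifted S I n. x s * y_at L k n (shifted S I n) s) =
     (\<Sum>n=1..N. \<Sum>s\<in>rest S n. x s * y_at L k n (S n) s) + x i * sum (lone_y S) I + x (Suc i) * sum (lone_y S) (lone S - I)"
proof -
  have XN: "lone S \<subseteq> {1..N}" by (auto simp: lone_def)
  have "(\<Sum>n=1..N. \<Sum>s\<in>shifted S I n. x s * y_at L k n (shifted S I n) s) = (\<Sum>n=1..N. (\<Sum>s\<in>rest S n. x s * y_at L k n (S n) s) +
      ((if n \<in> I then x i * lone_y S n else 0) + (if n \<in> lone S - I then x (Suc i) * lone_y S n else 0)))"
  proof (rule sum.cong[OF refl])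
    fix n assume n: "n \<in> {1..N}"
    have "(\<Sum>s\<in>shifted S I n. x s * y_at L k n (shifted S I n) s) = (\<Sum>s\<in>S n. x (shift_at S I n s) * y_at L k n (shifted S I n) (shift_at S I n s))"
      unfolding shifted_eq by (simp add: sum.reindex[OF inj_shift_at])
    also have "\<dots> = (\<Sum>s\<in>S n. x (shift_at S I n s) * y_at L k n (S n) s)"
      by (intro sum.cong refl) (simp add: y_at_shift_at)
    also have "\<dots> = (\<Sum>s\<in>rest S n. x s * y_at L k n (S n) s) +
      ((if n \<in> I then x i * lone_y S n else 0) + (if n \<in> lone S - I then x (Suc i) * lone_y S n else 0))"
    proof (cases "n \<in> lone S")
      case True
      then have "i \<in> S n" by (simp add: lone_def)
      then have "(\<Sum>s\<in>S n. x (shift_at S I n s) * y_at L k n (S n) s) = x (shift_at S I n i) * y_at L k n (S n) i + (\<Sum>s\<in>S n - {i}. x (shift_at S I n s) * y_at L k n (S n) s)"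
        using low_tuplesD[OF S n] by (intro sum.remove) auto
      also have "(\<Sum>s\<in>S n - {i}. x (shift_at S I n s) * y_at L k n (S n) s) = (\<Sum>s\<in>S n - {i}. x s * y_at L k n (S n) s)"
        by (intro sum.cong refl) (auto simp: shift_at_def shift_def)
      finally show ?thesis using True by (auto simp: shift_at_def shift_def rest_def lone_y_def add.commute)
    next
      case False
      then show ?thesis using I by (auto simp: shift_at_def rest_def)
    qed
    finally show "(\<Sum>s\<in>shifted S I n. x s * y_at L k n (shifted S I n) s) = (\<Sum>s\<in>rest S n. x s * y_at L k n (S n) s) +
      ((if n \<in> I then x i * lone_y S n else 0) + (if n \<in> lone S - I then x (Suc i) * lone_y S n else 0))" .
  qed
  also have "\<dots> = (\<Sum>n=1..N. \<Sum>s\<in>rest S n. x s * y_at L k n (S n) s) + ((\<Sum>n=1..N. if n \<in> I then x i * lone_y S n else 0) +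
      (\<Sum>n=1..N. if n \<in> lone S - I then x (Suc i) * lone_y S n else 0))"
    by (simp add: sum.distrib)
  also have "(\<Sum>n=1..N. if n \<in> I then x i * lone_y S n else 0) = (\<Sum>n\<in>I. if n \<in> I then x i * lone_y S n else 0)"
    using I XN by (intro sum.mono_neutral_right) auto
  also have "(\<Sum>n=1..N. if n \<in> lone S - I then x (Suc i) * lone_y S n else 0) = (\<Sum>n\<in>lone S - I. if n \<in> lone S - I then x (Suc i) * lone_y S n else 0)"
    using XN by (intro sum.mono_neutral_right) auto
  finally show ?thesis by (simp add: sum_distrib_left)
qed

end

end

subsection \<open>Exchanging \<open>a\<^sub>i\<close> and \<open>a\<^bsub>i+1\<^esub>\<close>\<close>

context swap_setup
begin

lemma JJ_eq:
  assumes a: "a \<in> hdual L"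
  shows "JJ L p (linear_elt L \<eta>) N a k = (\<Sum>S\<in>low_tuples. rconst (\<Prod>n=1..N. \<Prod>s\<in>rest S n. om L (a s)) * Phi L p k N S *
     (\<Sum>I\<in>Pow (lone S). R.subset_weight (rconst (om L (a i))) (rconst (om L (a (Suc i)))) (lone_y S) I (lone S - I) *
        ((\<Sum>n=1..N. \<Sum>s\<in>rest S n. rconst (y_coeff L \<eta> s) * y_at L k n (S n) s)
          + rconst (y_coeff L \<eta> i) * sum (lone_y S) I + rconst (y_coeff L \<eta> (Suc i)) * sum (lone_y S) (lone S - I))))"
proof -
  define F where "F S = rconst (\<Prod>n=1..N. \<Prod>s\<in>S n. om L (a s)) * Phi L p k N S *
     (\<Sum>n=1..N. \<Sum>s\<in>S n. rconst (y_coeff L \<eta> s) * y_at L k n (S n) s)" for S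
  have "JJ L p (linear_elt L \<eta>) N a k = (\<Sum>S\<in>tuples L k N. F S)"
    unfolding JJ_def
  proof (rule sum.cong[OF refl])
    fix S assume S: "S \<in> tuples L k N"
    have "om L (pair L a (\<lambda>t. \<Sum>n=1..N. HS L (S n) t)) = (\<Prod>n=1..N. om L (pair L a (HS L (S n))))"
      by (simp add: pair_sum_right om_sum)
    also have "\<dots> = (\<Prod>n=1..N. \<Prod>s\<in>S n. om L (a s))"
      using tuplesD[OF S] a by (intro prod.cong refl om_pair_HS)
    finally have w: "om L (pair L a (\<lambda>t. \<Sum>n=1..N. HS L (S n) t)) = (\<Prod>n=1..N. \<Prod>s\<in>S n. om L (a s))" .
    have e: "to_fract (EE L k N S (linear_elt L \<eta>)) = (\<Sum>n=1..N. \<Sum>s\<in>S n. rconst (y_coeff L \<eta> s) * y_at L k n (S n) s)"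
      using tuplesD[OF S] by (intro EE_linear_elt[OF L]) auto
    show "rconst (om L (pair L a (\<lambda>t. \<Sum>n=1..N. HS L (S n) t))) * Phi L p k N S * to_fract (EE L k N S (linear_elt L \<eta>)) = F S"
      unfolding w e F_def ..
  qed
  also have "\<dots> = (\<Sum>S\<in>low_tuples. \<Sum>I\<in>Pow (lone S). F (shifted S I))"
    by (rule sum_tuples)
  also have "\<dots> = (\<Sum>S\<in>low_tuples. rconst (\<Prod>n=1..N. \<Prod>s\<in>rest S n. om L (a s)) * Phi L p k N S *
     (\<Sum>I\<in>Pow (lone S). R.subset_weight (rconst (om L (a i))) (rconst (om L (a (Suc i)))) (lone_y S) I (lone S - I) *
        ((\<Sum>n=1..N. \<Sum>s\<in>rest S n. rconst (y_coeff L \<eta> s) * y_at L k n (S n) s)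
          + rconst (y_coeff L \<eta> i) * sum (lone_y S) I + rconst (y_coeff L \<eta> (Suc i)) * sum (lone_y S) (lone S - I))))"
  proof (rule sum.cong[OF refl])
    fix S assume S: "S \<in> low_tuples"
    show "(\<Sum>I\<in>Pow (lone S). F (shifted S I)) = rconst (\<Prod>n=1..N. \<Prod>s\<in>rest S n. om L (a s)) * Phi L p k N S *
     (\<Sum>I\<in>Pow (lone S). R.subset_weight (rconst (om L (a i))) (rconst (om L (a (Suc i)))) (lone_y S) I (lone S - I) *
        ((\<Sum>n=1..N. \<Sum>s\<in>rest S n. rconst (y_coeff L \<eta> s) * y_at L k n (S n) s)
          + rconst (y_coeff L \<eta> i) * sum (lone_y S) I + rconst (y_coeff L \<eta> (Suc i)) * sum (lone_y S) (lone S - I)))"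
      unfolding sum_distrib_left[of _ _ "Pow (lone S)"]
    proof (rule sum.cong[OF refl])
      fix I assume "I \<in> Pow (lone S)"
      then have I: "I \<subseteq> lone S" by simp
      show "F (shifted S I) = rconst (\<Prod>n=1..N. \<Prod>s\<in>rest S n. om L (a s)) * Phi L p k N S *
        (R.subset_weight (rconst (om L (a i))) (rconst (om L (a (Suc i)))) (lone_y S) I (lone S - I) *
        ((\<Sum>n=1..N. \<Sum>s\<in>rest S n. rconst (y_coeff L \<eta> s) * y_at L k n (S n) s)
          + rconst (y_coeff L \<eta> i) * sum (lone_y S) I + rconst (y_coeff L \<eta> (Suc i)) * sum (lone_y S) (lone S - I)))"
        unfolding F_def prod_shifted[OF S I] sum_shifted[OF S I] Phi_shifted[OF S I] R.subset_weight_def rconst_mult rconst_power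
        by (simp only: mult_ac)
    qed
  qed
  finally show ?thesis .
qed

text \<open>The coefficients at \<open>i\<close> and \<open>Suc i\<close> may change, but only in
  the shape given by \<open>U\<close> and \<open>V\<close>: the \<open>U\<close> part is absorbed by
  \<open>subset_sum_commute\<close>, the \<open>V\<close> part by
  \<open>weighted_commute\<close>.\<close>

theorem JJ_swap:
  assumes a: "a \<in> hdual L" and b: "b \<in> hdual L"
    and ab: "b i = a (Suc i)" "b (Suc i) = a i" "\<And>s. s \<noteq> i \<Longrightarrow> s \<noteq> Suc i \<Longrightarrow> b s = a s"
    and \<eta>\<theta>: "\<And>s. s \<in> {1..L} \<Longrightarrow> s \<noteq> i \<Longrightarrow> s \<noteq> Suc i \<Longrightarrow> y_coeff L \<theta> s = y_coeff L \<eta> s"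
    and \<eta>: "y_coeff L \<eta> i = U + V * om L (a (Suc i))" "y_coeff L \<eta> (Suc i) = U + om L 1 * V * om L (a i)"
    and \<theta>: "y_coeff L \<theta> i = U + V * om L (a i)" "y_coeff L \<theta> (Suc i) = U + om L 1 * V * om L (a (Suc i))"
  shows "JJ L p (linear_elt L \<eta>) N a k = JJ L p (linear_elt L \<theta>) N b k"
  unfolding JJ_eq[OF a] JJ_eq[OF b]
proof (rule sum.cong[OF refl])
  fix S assume S: "S \<in> low_tuples"
  note pr = low_tuplesD[OF S]
  define A B where "A = rconst (om L (a i))" and "B = rconst (om L (a (Suc i)))"
  define X where "X = lone S"
  define y where "y = lone_y S"
  have split: "rest S n = insert i (insert (Suc i) (S n - {i, Suc i}))" "n \<notin> lone S" if "n \<in> {1..N}" "Suc i \<in> S n" for n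
    using that pr(4)[OF that] by (auto simp: rest_def lone_def)
  have off: "i \<notin> rest S n" if "n \<in> {1..N}" "Suc i \<notin> S n" for n
    using that by (auto simp: rest_def lone_def)
  have sub: "rest S n \<subseteq> S n" for n by (auto simp: rest_def)
  have c1: "(\<Prod>n=1..N. \<Prod>s\<in>rest S n. om L (b s)) = (\<Prod>n=1..N. \<Prod>s\<in>rest S n. om L (a s))"
  proof (rule prod.cong[OF refl])
    fix n assume n: "n \<in> {1..N}"
    have o: "(\<Prod>s\<in>S n - {i, Suc i}. om L (b s)) = (\<Prod>s\<in>S n - {i, Suc i}. om L (a s))"
      using ab by (intro prod.cong refl) auto
    show "(\<Prod>s\<in>rest S n. om L (b s)) = (\<Prod>s\<in>rest S n. om L (a s))"
    proof (cases "Suc i \<in> S n")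
      case True
      then show ?thesis using pr(3)[OF n] by (simp add: split[OF n True] o ab)
    next
      case False
      then have "s \<noteq> i \<and> s \<noteq> Suc i" if "s \<in> rest S n" for s
        using that sub[of n] off[OF n] by auto
      then show ?thesis using ab(3) by (intro prod.cong refl) simp
    qed
  qed
  have c2: "(\<Sum>n=1..N. \<Sum>s\<in>rest S n. rconst (y_coeff L \<theta> s) * y_at L k n (S n) s) =
     (\<Sum>n=1..N. \<Sum>s\<in>rest S n. rconst (y_coeff L \<eta> s) * y_at L k n (S n) s)"
  proof (rule sum.cong[OF refl])
    fix n assume n: "n \<in> {1..N}"
    have o: "(\<Sum>s\<in>S n - {i, Suc i}. rconst (y_coeff L \<theta> s) * y_at L k n (S n) s) = (\<Sum>s\<in>S n - {i, Suc i}. rconst (y_coeff L \<eta> s) * y_at L k n (S n) s)"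
      using \<eta>\<theta> pr(1)[OF n] by (intro sum.cong refl) auto
    show "(\<Sum>s\<in>rest S n. rconst (y_coeff L \<theta> s) * y_at L k n (S n) s) = (\<Sum>s\<in>rest S n. rconst (y_coeff L \<eta> s) * y_at L k n (S n) s)"
    proof (cases "Suc i \<in> S n")
      case True
      \<comment> \<open>With y the variable at \<open>Suc i\<close>, a component containing both
        elements contributes y times \<omega>(U + V B) + U + \<omega> V A = (1 + \<omega>) U +
        \<omega> V (A + B), which is symmetric in A and B.\<close>
      then have "y_at L k n (S n) i = rconst (om L 1) * y_at L k n (S n) (Suc i)"
        using pr(3)[OF n] by (intro y_at_Suc)
      then show ?thesis using pr(3)[OF n] 
        by (simp add: split[OF n True] o \<eta> \<theta> rconst_add rconst_mult) (simp add: algebra_simps)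
    next
      case False
      then have "s \<in> {1..L} \<and> s \<noteq> i \<and> s \<noteq> Suc i" if "s \<in> rest S n" for s
        using that sub[of n] off[OF n] pr(1)[OF n] by auto
      then show ?thesis using \<eta>\<theta> by (intro sum.cong refl) simp
    qed
  qed
  define c where "c = (\<Sum>n=1..N. \<Sum>s\<in>rest S n. rconst (y_coeff L \<eta> s) * y_at L k n (S n) s)"
  have X: "finite X" by (simp add: X_def lone_def)
  have gen: "R.generic X y"
    unfolding R.generic_def y_def lone_y_def
    using y_at_nz y_at_neq[where c = 1] y_at_neq by auto
  \<comment> \<open>Since \<open>sum y I + sum y (X - I) = sum y X\<close>, the part with
    \<open>u\<close> does not depend on \<open>I\<close> and leaves the plain sum of
    weights.\<close>
  have lin: "(\<Sum>I\<in>Pow X. w I (X - I) * (c + (u + v * t) * sum y I + (u + z * v * r) * sum y (X - I)))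
     = (c + u * sum y X) * (\<Sum>I\<in>Pow X. w I (X - I)) + v * (\<Sum>I\<in>Pow X. w I (X - I) * (t * sum y I + z * r * sum y (X - I)))"
    for u v t r z and w :: "nat set \<Rightarrow> nat set \<Rightarrow> rfun"
    unfolding sum_distrib_left[of _ _ "Pow X"] sum.distrib[symmetric]
  proof (rule sum.cong[OF refl])
    fix I assume "I \<in> Pow X"
    then have "sum y X = sum y I + sum y (X - I)" using X by (simp add: sum.subset_diff add.commute)
    then show "w I (X - I) * (c + (u + v * t) * sum y I + (u + z * v * r) * sum y (X - I))
     = (c + u * sum y X) * w I (X - I) + v * (w I (X - I) * (t * sum y I + z * r * sum y (X - I)))"
      by (simp add: algebra_simps)
  qed
  have "(\<Sum>I\<in>Pow X. R.subset_weight A B y I (X - I) * (c + (rconst U + rconst V * B) * sum y I + (rconst U + rconst (om L 1) * rconst V * A) * sum y (X - I))) =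
     (\<Sum>I\<in>Pow X. R.subset_weight B A y I (X - I) * (c + (rconst U + rconst V * A) * sum y I + (rconst U + rconst (om L 1) * rconst V * B) * sum y (X - I)))"
    unfolding lin
    using R.weighted_commute[OF X gen ff_residue_nz[OF L p], of A B] R.subset_sum_commute[OF X gen, of A B]
    by (simp add: R.subset_sum_def)
  then show "rconst (\<Prod>n=1..N. \<Prod>s\<in>rest S n. om L (a s)) * Phi L p k N S *
     (\<Sum>I\<in>Pow (lone S). R.subset_weight (rconst (om L (a i))) (rconst (om L (a (Suc i)))) (lone_y S) I (lone S - I) *
        ((\<Sum>n=1..N. \<Sum>s\<in>rest S n. rconst (y_coeff L \<eta> s) * y_at L k n (S n) s)
          + rconst (y_coeff L \<eta> i) * sum (lone_y S) I + rconst (y_coeff L \<eta> (Suc i)) * sum (lone_y S) (lone S - I))) =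
     rconst (\<Prod>n=1..N. \<Prod>s\<in>rest S n. om L (b s)) * Phi L p k N S *
     (\<Sum>I\<in>Pow (lone S). R.subset_weight (rconst (om L (b i))) (rconst (om L (b (Suc i)))) (lone_y S) I (lone S - I) *
        ((\<Sum>n=1..N. \<Sum>s\<in>rest S n. rconst (y_coeff L \<theta> s) * y_at L k n (S n) s)
          + rconst (y_coeff L \<theta> i) * sum (lone_y S) I + rconst (y_coeff L \<theta> (Suc i)) * sum (lone_y S) (lone S - I)))"
    unfolding c1 c2 \<eta> \<theta> ab(1,2) rconst_add rconst_mult
    unfolding A_def[symmetric] B_def[symmetric] X_def[symmetric] y_def[symmetric] c_def[symmetric]
    by (rule arg_cong)
qed

end

subsection \<open>The coefficients of \<open>h\<^bsub>1,a\<^esub>\<close>\<close>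

lemma om_eq_cis: "om L (of_real r) = cis (2 * pi * r / real L)"
  by (simp add: om_def cis_conv_exp mult_ac)

lemma qnum_eq:
  assumes "L \<ge> 2"
  shows "qnum L n = (om L (of_nat n / 2) - om L (- (of_nat n / 2))) / (om L (1 / 2) - om L (- (1 / 2)))"
proof -
  have d: "om L (of_nat m / 2) - om L (- (of_nat m / 2)) = 2 * \<i> * of_real (sin (pi * real m / real L))" for m
    using om_eq_cis[of L "real m / 2"] om_eq_cis[of L "- (real m / 2)"]
    by (simp add: complex_eq_iff)
  show ?thesis
    using d[of n] d[of 1] by (simp add: qnum_def)
qed

lemma om_half_diff:
  assumes "L \<ge> 2"
  shows "om L (1 / 2) - om L (- (1 / 2)) \<noteq> 0"
proof
  assume "om L (1 / 2) - om L (- (1 / 2)) = 0"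
  then have "om L (1 / 2) * om L (1 / 2) = om L (- (1 / 2)) * om L (1 / 2)" by simp
  then have "om L 1 = 1" by (simp flip: om_add)
  with om_1_neq_1[OF assms] show False by simp
qed

lemma qnum_nz:
  assumes "n \<in> {1..L-1}"
  shows "qnum L n \<noteq> 0"
proof -
  have "0 < sin (pi * real n / real L)" "0 < sin (pi / real L)"
    using assms by (auto intro!: sin_gt_zero simp: field_simps)
  then show ?thesis by (simp add: qnum_def)
qed

text \<open>The telescoped form of the geometric sum of \<omega>^(m - (n+1)/2) over m = 1, ..., n,
  which equals [n]; this is why \<open>h1\<close> is divided by \<open>qnum L k\<close>.\<close>

lemma om_geometric:
  assumes "L \<ge> 2"
  shows "om L (- ((of_nat n + 1) / 2)) * (om L 1 ^ Suc n - om L 1) = qnum L n * (om L 1 - 1)"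
proof -
  define D where "D = om L (1 / 2) - om L (- (1 / 2))"
  have D: "D \<noteq> 0" using om_half_diff[OF assms] by (simp add: D_def)
  have w: "om L 1 - 1 = om L (1 / 2) * D"
    by (simp add: D_def right_diff_distrib flip: om_add)
  have "om L (- ((of_nat n + 1) / 2)) * (om L 1 ^ Suc n - om L 1) =
      om L (- ((of_nat n + 1) / 2) + of_nat (Suc n)) - om L (- ((of_nat n + 1) / 2) + 1)"
    unfolding om_of_nat[symmetric] right_diff_distrib om_add[symmetric] ..
  also have "\<dots> = om L (1 / 2) * (om L (of_nat n / 2) - om L (- (of_nat n / 2)))"
  proof -
    have "- ((of_nat n + 1) / 2) + of_nat (Suc n) = 1 / 2 + of_nat n / (2::complex)"
      "- ((of_nat n + 1) / 2) + 1 = 1 / 2 + - (of_nat n / (2::complex))"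
      by (simp_all add: field_simps)
    then show ?thesis unfolding right_diff_distrib om_add[symmetric] by simp
  qed
  finally show ?thesis
    using D by (simp add: w qnum_eq[OF assms] flip: D_def)
qed

text \<open>The differences of neighbouring coefficients are proportional to \<omega>^(-s), which
  the prefactor in \<open>y_coeff\<close> cancels. The constant, written as a product, is 1:
  \<open>iota1\<close> is mapped to the sum of all y, whatever the tuple.\<close>

lemma y_coeff_iota:
  assumes L: "L \<ge> 2" and s: "s \<in> {1..L}"
  shows "y_coeff L (\<lambda>i. om L ((of_nat L - of_nat i) / 2) * qnum L i) s = om L (- (1 / 2)) * om L (1 / 2)"
proof -
  define D where "D = om L (1 / 2) - om L (- (1 / 2))"
  have D: "D \<noteq> 0" using om_half_diff[OF L] by (simp add: D_def)
  define \<eta> where "\<eta> i = om L ((of_nat L - of_nat i) / 2) * qnum L i" for i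
  have e: "\<eta> i = (om L (of_nat L / 2) - om L (of_nat L / 2 - of_nat i)) / D" for i
  proof -
    have t: "(of_nat L - of_nat i) / 2 + of_nat i / 2 = of_nat L / (2::complex)"
      "(of_nat L - of_nat i) / 2 + - (of_nat i / 2) = of_nat L / 2 - (of_nat i :: complex)" for i L :: nat
      by (simp_all add: field_simps)
    show ?thesis
      unfolding \<eta>_def qnum_eq[OF L] D_def[symmetric] times_divide_eq_right right_diff_distrib om_add[symmetric] t ..
  qed
  have "\<eta> 0 = 0" by (simp add: e)
  \<comment> \<open>\<omega>^L = 1. With \<open>\<eta> 0 = 0\<close> the guards in
    \<open>y_coeff\<close> can then be dropped.\<close>
  moreover have "\<eta> L = 0"
    unfolding e om_diff using om_self[of L] L by simp
  ultimately have "y_coeff L \<eta> s = om L (- ((of_nat L + 1 - 2 * of_nat s) / 2)) * (\<eta> s - \<eta> (s - 1))"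
    using s by (cases "s = 1"; cases "s = L") (auto simp: y_coeff_def)
  also have "\<eta> s - \<eta> (s - 1) = (om L (of_nat L / 2 - of_nat (s - 1)) - om L (of_nat L / 2 - of_nat s)) / D"
    by (simp add: e diff_divide_distrib)
  also have "om L (- ((of_nat L + 1 - 2 * of_nat s) / 2)) * \<dots> = (om L (1 / 2) - om L (- (1 / 2))) / D"
  proof -
    have t: "- ((of_nat L + 1 - 2 * of_nat s) / 2) + (of_nat L / 2 - of_nat (s - 1)) = 1 / (2::complex)"
      "- ((of_nat L + 1 - 2 * of_nat s) / 2) + (of_nat L / 2 - of_nat s) = - (1 / (2::complex))"
      using s by (simp_all add: field_simps of_nat_diff)
    show ?thesis
      unfolding times_divide_eq_right right_diff_distrib om_add[symmetric] t ..
  qed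
  also have "\<dots> = om L (- (1 / 2)) * om L (1 / 2)"
    using D by (simp add: D_def flip: om_add)
  finally show ?thesis unfolding \<eta>_def .
qed

section \<open>Closed form of the coefficients of h\<close>

text \<open>As \<open>s\<close> is not in \<open>S\<close>, the exponent \<open>pos S s\<close> is
  the number of elements of \<open>S\<close> below \<open>s\<close>.\<close>

definition omit_sum :: "nat \<Rightarrow> nat \<Rightarrow> (nat \<Rightarrow> complex) \<Rightarrow> nat \<Rightarrow> complex" where
  "omit_sum L l x s = (\<Sum>S | S \<subseteq> {1..L} \<and> card S = l \<and> s \<notin> S. (\<Prod>t\<in>S. x t) * om L 1 ^ pos S s)"

definition esym :: "nat \<Rightarrow> nat \<Rightarrow> (nat \<Rightarrow> complex) \<Rightarrow> complex" where
  "esym L l x = (\<Sum>S | S \<subseteq> {1..L} \<and> card S = l. \<Prod>t\<in>S. x t)"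

lemma finite_subsets: "finite {S. S \<subseteq> {1..L::nat} \<and> P S}"
  by (rule finite_subset[of _ "Pow {1..L}"]) auto

lemma KK_eq: "a \<in> hdual L \<Longrightarrow> KK L l a = esym L l (\<lambda>s. om L (a s))"
  unfolding KK_def esym_def by (intro sum.cong refl om_pair_HS) auto

definition h1_coeff :: "nat \<Rightarrow> (nat \<Rightarrow> complex) \<Rightarrow> (nat \<Rightarrow> complex) \<Rightarrow> nat \<Rightarrow> complex" where
  "h1_coeff L d x i = (\<Sum>l=1..L-1. d l * (\<Sum>m=1..l. om L (of_nat m - of_nat i - (of_nat l + 1) / 2) *
     (\<Sum>S | S \<subseteq> {1..L} \<and> card S = l \<and> elt S m > i. \<Prod>s\<in>S. x s)))"

lemma mconst_uminus: "mconst (- z) = - mconst z"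
  by (simp add: mconst_def single_uminus)

lemma h1_eq_linear_elt:
  assumes "\<sigma> \<noteq> L - 1" "a \<in> hdual L"
  shows "h1 L c \<sigma> a = linear_elt L (\<lambda>i. - h1_coeff L (\<lambda>l. c \<sigma> l / (qnum L l * KK L l a)) (\<lambda>s. om L (a s)) i)"
proof -
  have W: "(\<Sum>S | S \<subseteq> {1..L} \<and> card S = l \<and> elt S m > i. om L (pair L a (HS L S))) =
     (\<Sum>S | S \<subseteq> {1..L} \<and> card S = l \<and> elt S m > i. \<Prod>s\<in>S. om L (a s))" for l m i
    using assms(2) by (intro sum.cong refl om_pair_HS) auto
  show ?thesis
    using assms(1) unfolding h1_def linear_elt_def h1_coeff_def W
    by (simp add: sum_negf mconst_uminus mult.commute)
qed

text \<open>Sum over \<open>m\<close> first: for fixed \<open>S\<close> the condition on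
  \<open>elt S m\<close> is \<open>pos S i < m\<close>, leaving a geometric sum of powers of
  \<omega>. The factor \<open>om L 1 - 1\<close> replaces a division.\<close>

lemma h1_coeff_closed:
  assumes L: "L \<ge> 2"
  shows "h1_coeff L d x i * (om L 1 - 1) = om L (- of_nat i) * (\<Sum>l=1..L-1. d l * om L (- ((of_nat l + 1) / 2)) *
     (\<Sum>S | S \<subseteq> {1..L} \<and> card S = l. (\<Prod>s\<in>S. x s) * (om L 1 ^ Suc l - om L 1 ^ Suc (pos S i))))"
proof -
  define w where "w = om L 1"
  have w1: "w \<noteq> 1" using om_1_neq_1[OF L] by (simp add: w_def)
  have inner: "(\<Sum>m=1..l. om L (of_nat m - of_nat i - (of_nat l + 1) / 2) *
     (\<Sum>S | S \<subseteq> {1..L} \<and> card S = l \<and> elt S m > i. \<Prod>s\<in>S. x s)) * (w - 1) =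
     om L (- of_nat i) * om L (- ((of_nat l + 1) / 2)) * (\<Sum>S | S \<subseteq> {1..L} \<and> card S = l. (\<Prod>s\<in>S. x s) * (w ^ Suc l - w ^ Suc (pos S i)))" for l
  proof -
    define C where "C = om L (- of_nat i) * om L (- ((of_nat l + 1) / 2))"
    have o: "om L (of_nat m - of_nat i - (of_nat l + 1) / 2) = C * w ^ m" for m
    proof -
      have "of_nat m - of_nat i - (of_nat l + 1) / 2 = - of_nat i + - ((of_nat l + 1) / 2) + (of_nat m :: complex)" by simp
      then show ?thesis unfolding C_def w_def om_of_nat[symmetric] om_add[symmetric] by (rule arg_cong)
    qed
    have "(\<Sum>m=1..l. om L (of_nat m - of_nat i - (of_nat l + 1) / 2) *
        (\<Sum>S | S \<subseteq> {1..L} \<and> card S = l \<and> elt S m > i. \<Prod>s\<in>S. x s)) =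
       (\<Sum>m=1..l. \<Sum>S | S \<subseteq> {1..L} \<and> card S = l. if i < elt S m then C * w ^ m * (\<Prod>s\<in>S. x s) else 0)"
      unfolding o sum_distrib_left
      by (intro sum.cong[OF refl], subst sum.inter_filter[symmetric, OF finite_subsets]) (simp add: conj_assoc)
    also have "\<dots> = (\<Sum>S | S \<subseteq> {1..L} \<and> card S = l. \<Sum>m=1..l. if i < elt S m then C * w ^ m * (\<Prod>s\<in>S. x s) else 0)"
      by (rule sum.swap)
    also have "\<dots> * (w - 1) = (\<Sum>S | S \<subseteq> {1..L} \<and> card S = l. C * ((\<Prod>s\<in>S. x s) * (w ^ Suc l - w ^ Suc (pos S i))))"
      unfolding sum_distrib_right[of _ "{S. S \<subseteq> {1..L} \<and> card S = l}"]
    proof (intro sum.cong[OF refl])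
      fix S assume "S \<in> {S. S \<subseteq> {1..L} \<and> card S = l}"
      then have S: "finite S" "card S = l" using finite_subset[of S "{1..L}"] by auto
      have le: "pos S i \<le> l" using S unfolding pos_def by (auto intro: card_mono)
      have "(\<Sum>m=1..l. if i < elt S m then C * w ^ m * (\<Prod>s\<in>S. x s) else 0) =
        (\<Sum>m=1..l. if pos S i < m then C * w ^ m * (\<Prod>s\<in>S. x s) else 0)"
        using S by (intro sum.cong refl) (simp add: less_elt_iff)
      also have "\<dots> = (\<Sum>m\<in>{Suc (pos S i)..l}. C * w ^ m * (\<Prod>s\<in>S. x s))"
        by (subst sum.inter_filter[symmetric]) (auto intro!: sum.cong)
      also have "\<dots> = C * (\<Prod>s\<in>S. x s) * (\<Sum>m\<in>{Suc (pos S i)..l}. w ^ m)"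
        by (simp add: sum_distrib_left mult_ac)
      finally have *: "(\<Sum>m=1..l. if i < elt S m then C * w ^ m * (\<Prod>s\<in>S. x s) else 0) =
        C * (\<Prod>s\<in>S. x s) * (\<Sum>m\<in>{Suc (pos S i)..l}. w ^ m)" .
      have "(\<Sum>m\<in>{Suc (pos S i)..l}. w ^ m) * (w - 1) = w ^ Suc l - w ^ Suc (pos S i)"
        using le
      proof (induction l rule: dec_induct)
        case (step n)
        then have "{Suc (pos S i)..Suc n} = insert (Suc n) {Suc (pos S i)..n}" by auto
        then show ?case using step by (simp add: algebra_simps)
      qed simp
      then show "(\<Sum>m=1..l. if i < elt S m then C * w ^ m * (\<Prod>s\<in>S. x s) else 0) * (w - 1) =
          C * ((\<Prod>s\<in>S. x s) * (w ^ Suc l - w ^ Suc (pos S i)))"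
        unfolding * by (simp add: mult.assoc)
    qed
    finally show ?thesis unfolding C_def sum_distrib_left .
  qed
  show ?thesis
    unfolding h1_coeff_def sum_distrib_right[of _ "{1..L-1}"] w_def[symmetric]
      sum_distrib_left[of "om L (- of_nat i)" _ "{1..L-1}"]
    by (rule sum.cong[OF refl], subst mult.assoc, subst inner) (simp only: mult_ac)
qed

lemma pos_notin:
  assumes "1 \<le> s" "s \<notin> S"
  shows "pos S (s - 1) = pos S s"
proof -
  have "{t \<in> S. t \<le> s - 1} = {t \<in> S. t \<le> s}" using assms by (auto simp: le_eq_less_or_eq)
  then show ?thesis by (simp add: pos_def)
qed

lemma pos_in:
  assumes "finite S" "1 \<le> s" "s \<in> S"
  shows "pos S s = Suc (pos S (s - 1))"
  using pos_Suc[of S "s - 1"] assms by simp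

lemma sum_mult_diff:
  fixes w :: complex
  shows "(\<Sum>S\<in>T. x S * (a S - w * b S)) = (\<Sum>S\<in>T. x S * a S) - w * (\<Sum>S\<in>T. x S * b S)"
  by (simp add: right_diff_distrib sum_subtractf sum_distrib_left mult_ac)

text \<open>The formula for \<open>h1_coeff\<close> also makes sense at i = 0 and i = L and vanishes
  there, so for every \<open>s\<close> the coefficient is a multiple of the difference of its values
  at \<open>s\<close> and \<open>s - 1\<close>.\<close>

lemma y_coeff_h1_coeff:
  assumes L: "L \<ge> 2" and c: "(\<Sum>l=1..L-1. c l) = 0" and e: "\<And>l. l \<in> {1..L-1} \<Longrightarrow> esym L l x \<noteq> 0"
    and s: "s \<in> {1..L}"
  shows "y_coeff L (\<lambda>i. - h1_coeff L (\<lambda>l. c l / (qnum L l * esym L l x)) x i) s =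
     om L (- ((of_nat L + 1) / 2)) * (\<Sum>l=1..L-1. c l / (qnum L l * esym L l x) * om L (- ((of_nat l + 1) / 2)) *
        (om L 1 ^ Suc l * esym L l x - om L 1 * omit_sum L l x s))"
proof -
  define w where "w = om L 1"
  have w1: "w - 1 \<noteq> 0" using om_1_neq_1[OF L] by (simp add: w_def)
  define d where "d l = c l / (qnum L l * esym L l x)" for l
  define h where "h = h1_coeff L d x"
  have h: "h i * (w - 1) = om L (- of_nat i) * (\<Sum>l=1..L-1. d l * om L (- ((of_nat l + 1) / 2)) *
     (\<Sum>S | S \<subseteq> {1..L} \<and> card S = l. (\<Prod>s\<in>S. x s) * (w ^ Suc l - w ^ Suc (pos S i))))" for i
    unfolding h_def w_def by (rule h1_coeff_closed[OF L])
  \<comment> \<open>This is where the vanishing sum of the \<open>c l\<close> enters: at i = 0 all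
    positions are 0, and by \<open>om_geometric\<close> the denominators cancel, so the l-th term is
    \<open>c l * (w - 1)\<close>.\<close>
  have "h 0 * (w - 1) = 0"
  proof -
    have "(\<Sum>l=1..L-1. d l * om L (- ((of_nat l + 1) / 2)) *
       (\<Sum>S | S \<subseteq> {1..L} \<and> card S = l. (\<Prod>s\<in>S. x s) * (w ^ Suc l - w ^ Suc (pos S 0))))
      = (\<Sum>l=1..L-1. c l * (w - 1))"
    proof (intro sum.cong[OF refl])
      fix l assume l: "l \<in> {1..L-1}"
      have "pos S 0 = 0" if "S \<subseteq> {1..L}" for S
      proof -
        have "{t \<in> S. t \<le> 0} = {}" using that by auto
        then show ?thesis unfolding pos_def by (simp only: card.empty)
      qed
      then have "(\<Sum>S | S \<subseteq> {1..L} \<and> card S = l. (\<Prod>s\<in>S. x s) * (w ^ Suc l - w ^ Suc (pos S 0))) = esym L l x * (w ^ Suc l - w)"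
        unfolding esym_def sum_distrib_right by (intro sum.cong refl) simp
      then have "d l * om L (- ((of_nat l + 1) / 2)) *
       (\<Sum>S | S \<subseteq> {1..L} \<and> card S = l. (\<Prod>s\<in>S. x s) * (w ^ Suc l - w ^ Suc (pos S 0))) =
        d l * esym L l x * (om L (- ((of_nat l + 1) / 2)) * (w ^ Suc l - w))" by (simp add: mult_ac)
      also have "\<dots> = d l * esym L l x * (qnum L l * (w - 1))"
        unfolding w_def om_geometric[OF L] ..
      also have "\<dots> = c l * (w - 1)"
        using e[OF l] qnum_nz[OF l] by (simp add: d_def)
      finally show "d l * om L (- ((of_nat l + 1) / 2)) *
       (\<Sum>S | S \<subseteq> {1..L} \<and> card S = l. (\<Prod>s\<in>S. x s) * (w ^ Suc l - w ^ Suc (pos S 0))) = c l * (w - 1)" .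
    qed
    then show ?thesis unfolding h using c by (simp flip: sum_distrib_right)
  qed
  then have h0: "h 0 = 0" using w1 by simp
  have "h L * (w - 1) = 0"
  proof -
    have "pos S L = card S" if "S \<subseteq> {1..L}" for S
    proof -
      have "{t \<in> S. t \<le> L} = S" using that by auto
      then show ?thesis unfolding pos_def by (simp only:)
    qed
    then show ?thesis unfolding h by simp
  qed
  then have hL: "h L = 0" using w1 by simp
  have "(h s - h (s - 1)) * (w - 1) = om L (- of_nat s) * (\<Sum>l=1..L-1. d l * om L (- ((of_nat l + 1) / 2)) *
     (\<Sum>S | S \<subseteq> {1..L} \<and> card S = l. (\<Prod>s\<in>S. x s) * ((w ^ Suc l - w ^ Suc (pos S s)) - w * (w ^ Suc l - w ^ Suc (pos S (s - 1))))))"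
  proof -
    have "- of_nat (s - 1) = - of_nat s + (1::complex)" using s by (simp add: of_nat_diff)
    then have o: "om L (- of_nat (s - 1)) = om L (- of_nat s) * w" unfolding w_def om_add[symmetric] by simp
    show ?thesis
      unfolding left_diff_distrib[of "h s"] h o sum_mult_diff by (simp only: right_diff_distrib mult.assoc)
  qed
  also have "\<dots> = om L (- of_nat s) * (\<Sum>l=1..L-1. d l * om L (- ((of_nat l + 1) / 2)) *
     ((1 - w) * (w ^ Suc l * esym L l x - w * omit_sum L l x s)))"
  proof (rule arg_cong[where f = "(*) (om L (- of_nat s))"], rule sum.cong[OF refl])
    fix l
    \<comment> \<open>For \<open>s \<in> S\<close> the position grows by one from
      \<open>s - 1\<close> to \<open>s\<close>, and the extra factor \<open>w\<close> cancels the
      two position terms. Otherwise the positions agree and \<open>1 - w\<close> factors out. So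
      only subsets avoiding \<open>s\<close> keep a position term, giving
      \<open>omit_sum\<close>.\<close>
    have "(\<Sum>S | S \<subseteq> {1..L} \<and> card S = l. (\<Prod>s\<in>S. x s) * ((w ^ Suc l - w ^ Suc (pos S s)) - w * (w ^ Suc l - w ^ Suc (pos S (s - 1)))))
      = (\<Sum>S | S \<subseteq> {1..L} \<and> card S = l. (1 - w) * (w ^ Suc l * (\<Prod>s\<in>S. x s) - (if s \<notin> S then w * ((\<Prod>s\<in>S. x s) * w ^ pos S s) else 0)))"
    proof (intro sum.cong[OF refl])
      fix S assume "S \<in> {S. S \<subseteq> {1..L} \<and> card S = l}"
      then have fin: "finite S" using finite_subset[of S "{1..L}"] by auto
      show "(\<Prod>s\<in>S. x s) * ((w ^ Suc l - w ^ Suc (pos S s)) - w * (w ^ Suc l - w ^ Suc (pos S (s - 1)))) =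
        (1 - w) * (w ^ Suc l * (\<Prod>s\<in>S. x s) - (if s \<notin> S then w * ((\<Prod>s\<in>S. x s) * w ^ pos S s) else 0))"
      proof (cases "s \<in> S")
        case True
        then have "pos S s = Suc (pos S (s - 1))" using s fin by (intro pos_in) auto
        then show ?thesis using True by (simp add: algebra_simps)
      next
        case False
        then have "pos S (s - 1) = pos S s" using s by (intro pos_notin) auto
        then show ?thesis using False by (simp add: algebra_simps)
      qed
    qed
    also have "\<dots> = (1 - w) * (w ^ Suc l * esym L l x - w * omit_sum L l x s)"
    proof -
      have "(\<Sum>S | S \<subseteq> {1..L} \<and> card S = l. if s \<notin> S then w * ((\<Prod>s\<in>S. x s) * w ^ pos S s) else 0) =
        (\<Sum>S | S \<subseteq> {1..L} \<and> card S = l \<and> s \<notin> S. w * ((\<Prod>s\<in>S. x s) * w ^ pos S s))"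
        by (subst sum.inter_filter[symmetric, OF finite_subsets]) (simp add: conj_assoc)
      then have "(\<Sum>S | S \<subseteq> {1..L} \<and> card S = l. if s \<notin> S then w * ((\<Prod>s\<in>S. x s) * w ^ pos S s) else 0) = w * omit_sum L l x s"
        by (simp add: omit_sum_def sum_distrib_left w_def)
      then show ?thesis
        unfolding sum_distrib_left[symmetric] sum_subtractf esym_def by simp
    qed
    finally show "d l * om L (- ((of_nat l + 1) / 2)) * (\<Sum>S | S \<subseteq> {1..L} \<and> card S = l. (\<Prod>s\<in>S. x s) * ((w ^ Suc l - w ^ Suc (pos S s)) - w * (w ^ Suc l - w ^ Suc (pos S (s - 1)))))
      = d l * om L (- ((of_nat l + 1) / 2)) * ((1 - w) * (w ^ Suc l * esym L l x - w * omit_sum L l x s))" by simp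
  qed
  also have "\<dots> = - (om L (- of_nat s) * (\<Sum>l=1..L-1. d l * om L (- ((of_nat l + 1) / 2)) *
     (w ^ Suc l * esym L l x - w * omit_sum L l x s))) * (w - 1)"
    unfolding sum_distrib_left sum_distrib_right sum_negf[symmetric]
    by (intro sum.cong refl) (simp add: algebra_simps)
  finally have dh: "h s - h (s - 1) = - (om L (- of_nat s) * (\<Sum>l=1..L-1. d l * om L (- ((of_nat l + 1) / 2)) *
     (w ^ Suc l * esym L l x - w * omit_sum L l x s)))"
    by (rule mult_right_cancel[THEN iffD1, OF w1])
  have "y_coeff L (\<lambda>i. - h i) s = - (om L (- ((of_nat L + 1 - 2 * of_nat s) / 2)) * (h s - h (s - 1)))"
    using s h0 hL by (cases "s = 1"; cases "s = L") (auto simp: y_coeff_def algebra_simps)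
  also have "\<dots> = om L (- ((of_nat L + 1 - 2 * of_nat s) / 2)) * om L (- of_nat s) * (\<Sum>l=1..L-1. d l * om L (- ((of_nat l + 1) / 2)) *
     (w ^ Suc l * esym L l x - w * omit_sum L l x s))"
    unfolding dh by simp
  also have "om L (- ((of_nat L + 1 - 2 * of_nat s) / 2)) * om L (- of_nat s) = om L (- ((of_nat L + 1) / 2))"
  proof -
    have "- ((of_nat L + 1 - 2 * of_nat s) / 2) + - of_nat s = - ((of_nat L + 1) / (2::complex))" by (simp add: field_simps)
    then show ?thesis unfolding om_add[symmetric] by simp
  qed
  finally show ?thesis unfolding h_def d_def w_def .
qed

subsection \<open>Invariance under the Weyl group\<close>

definition swap_adj :: "nat \<Rightarrow> nat \<Rightarrow> nat" where
  "swap_adj i s = (if s = i then Suc i else if s = Suc i then i else s)"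

lemma swap_adj_swap_adj [simp]: "swap_adj i (swap_adj i s) = s"
  by (simp add: swap_adj_def)

lemma swap_adj_image_swap_adj [simp]: "swap_adj i ` swap_adj i ` S = S"
  by (simp add: image_image)

lemma inj_swap_adj: "inj_on (swap_adj i) S"
  by (metis inj_onI swap_adj_swap_adj)

lemma swap_adj_image_subset: "i \<in> {1..L-1} \<Longrightarrow> swap_adj i ` S \<subseteq> {1..L} \<longleftrightarrow> S \<subseteq> {1..L}"
  by (force simp: swap_adj_def subset_iff)

lemma card_swap_adj_image [simp]: "card (swap_adj i ` S) = card S"
  by (rule card_image[OF inj_swap_adj])

lemma prod_swap_adj_image: "(\<Prod>t\<in>swap_adj i ` S. x t) = (\<Prod>t\<in>S. x (swap_adj i t))"
  by (simp add: prod.reindex[OF inj_swap_adj])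

text \<open>For \<open>s\<close> different from \<open>i\<close>, the bound \<open>s\<close> does
  not separate \<open>i\<close> from \<open>Suc i\<close>.\<close>

lemma pos_swap_adj_image:
  assumes "s \<noteq> i"
  shows "pos (swap_adj i ` S) s = pos S s"
proof -
  have "swap_adj i t \<le> s \<longleftrightarrow> t \<le> s" for t using assms by (auto simp: swap_adj_def)
  then have "{t \<in> swap_adj i ` S. t \<le> s} = swap_adj i ` {t \<in> S. t \<le> s}" by auto
  then show ?thesis by (simp add: pos_def)
qed

lemma esym_swap_adj:
  assumes "i \<in> {1..L-1}"
  shows "esym L l (\<lambda>t. x (swap_adj i t)) = esym L l x"
  unfolding esym_def
  by (rule sum.reindex_bij_witness[where i = "image (swap_adj i)" and j = "image (swap_adj i)"])
     (simp_all add: swap_adj_image_subset[OF assms] prod_swap_adj_image del: One_nat_def)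

lemma omit_sum_swap_adj:
  assumes i: "i \<in> {1..L-1}" and s: "s \<noteq> i" "s \<noteq> Suc i"
  shows "omit_sum L l (\<lambda>t. x (swap_adj i t)) s = omit_sum L l x s"
proof -
  have "swap_adj i s = s" using s by (simp add: swap_adj_def)
  then have m: "s \<in> swap_adj i ` S \<longleftrightarrow> s \<in> S" for S by (metis image_eqI swap_adj_image_swap_adj)
  show ?thesis
    unfolding omit_sum_def
    by (rule sum.reindex_bij_witness[where i = "image (swap_adj i)" and j = "image (swap_adj i)"])
       (simp_all add: swap_adj_image_subset[OF i] prod_swap_adj_image m pos_swap_adj_image[OF s(1)] del: One_nat_def)
qed

definition omit_both_sum :: "nat \<Rightarrow> nat \<Rightarrow> (nat \<Rightarrow> complex) \<Rightarrow> nat \<Rightarrow> complex" where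
  "omit_both_sum L l x i = (\<Sum>S | S \<subseteq> {1..L} \<and> card S = l \<and> i \<notin> S \<and> Suc i \<notin> S. (\<Prod>t\<in>S. x t) * om L 1 ^ pos S i)"

text \<open>\<open>Suc (card S) = l\<close> instead of \<open>card S = l - 1\<close>, so that the
  sum is empty for l = 0.\<close>

definition omit_both_sum_pred :: "nat \<Rightarrow> nat \<Rightarrow> (nat \<Rightarrow> complex) \<Rightarrow> nat \<Rightarrow> complex" where
  "omit_both_sum_pred L l x i = (\<Sum>S | S \<subseteq> {1..L} \<and> Suc (card S) = l \<and> i \<notin> S \<and> Suc i \<notin> S. (\<Prod>t\<in>S. x t) * om L 1 ^ pos S i)"

lemma omit_both_sum_swap_adj:
  "omit_both_sum L l (\<lambda>t. x (swap_adj i t)) i = omit_both_sum L l x i" "omit_both_sum_pred L l (\<lambda>t. x (swap_adj i t)) i = omit_both_sum_pred L l x i"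
proof -
  have "(\<Prod>t\<in>S. x (swap_adj i t)) = (\<Prod>t\<in>S. x t)" if "i \<notin> S" "Suc i \<notin> S" for S
    using that by (intro prod.cong refl) (auto simp: swap_adj_def)
  then show "omit_both_sum L l (\<lambda>t. x (swap_adj i t)) i = omit_both_sum L l x i" "omit_both_sum_pred L l (\<lambda>t. x (swap_adj i t)) i = omit_both_sum_pred L l x i"
    unfolding omit_both_sum_def omit_both_sum_pred_def by (auto intro!: sum.cong)
qed

lemma pos_insert_greater: "i < j \<Longrightarrow> pos (insert j S) i = pos S i"
  unfolding pos_def by (rule arg_cong[where f = card]) auto

lemma pos_insert_le:
  assumes "finite S" "j \<le> i" "j \<notin> S"
  shows "pos (insert j S) i = Suc (pos S i)"
proof -
  have "{t \<in> insert j S. t \<le> i} = insert j {t \<in> S. t \<le> i}" using assms by auto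
  then show ?thesis using assms by (simp add: pos_def)
qed

lemma pos_Suc_notin: "Suc i \<notin> S \<Longrightarrow> pos S (Suc i) = pos S i"
  using pos_notin[of "Suc i" S] by simp

lemma sum_subsets_split:
  fixes F :: "nat set \<Rightarrow> 'b::comm_monoid_add"
  assumes "j \<in> {1..L}" "i \<noteq> j"
  shows "(\<Sum>S | S \<subseteq> {1..L} \<and> card S = l \<and> i \<notin> S. F S) =
    (\<Sum>S | S \<subseteq> {1..L} \<and> card S = l \<and> i \<notin> S \<and> j \<notin> S. F S) +
    (\<Sum>S | S \<subseteq> {1..L} \<and> Suc (card S) = l \<and> i \<notin> S \<and> j \<notin> S. F (insert j S))"
proof -
  let ?P = "\<lambda>S. S \<subseteq> {1..L} \<and> card S = l \<and> i \<notin> S"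
  have "(\<Sum>S | ?P S. F S) = (\<Sum>S | S \<subseteq> {1..L} \<and> card S = l \<and> i \<notin> S \<and> j \<notin> S. F S) + (\<Sum>S | ?P S \<and> j \<in> S. F S)"
    by (subst sum.union_disjoint[symmetric]) (auto simp: finite_subsets intro!: sum.cong)
  also have "(\<Sum>S | ?P S \<and> j \<in> S. F S) = (\<Sum>S | S \<subseteq> {1..L} \<and> Suc (card S) = l \<and> i \<notin> S \<and> j \<notin> S. F (insert j S))"
  proof (rule sum.reindex_bij_witness[where i = "insert j" and j = "\<lambda>S. S - {j}"])
    fix S assume S: "S \<in> {S. ?P S \<and> j \<in> S}"
    then have "finite S" using finite_subset[of S "{1..L}"] by auto
    then have "Suc (card (S - {j})) = card S" using S by (intro card_Suc_Diff1) auto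
    then show "S - {j} \<in> {S. S \<subseteq> {1..L} \<and> Suc (card S) = l \<and> i \<notin> S \<and> j \<notin> S}" using S by auto
    show "insert j (S - {j}) = S" using S by auto
    then show "F (insert j (S - {j})) = F S" by simp
  next
    fix S assume S: "S \<in> {S. S \<subseteq> {1..L} \<and> Suc (card S) = l \<and> i \<notin> S \<and> j \<notin> S}"
    then have "finite S" using finite_subset[of S "{1..L}"] by auto
    then have "card (insert j S) = l" using S by simp
    then show "insert j S \<in> {S. ?P S \<and> j \<in> S}" using S assms by simp
    show "insert j S - {j} = S" using S by auto
  qed
  finally show ?thesis .
qed

text \<open>Split by whether \<open>S\<close> contains the other one of \<open>i\<close>,
  \<open>Suc i\<close>. In the second identity that element is \<open>i\<close>, which lies below
  \<open>Suc i\<close> and adds one to the position, hence the extra \<omega>.\<close>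

lemma omit_sum_eq:
  assumes i: "i \<in> {1..L-1}"
  shows "omit_sum L l x i = omit_both_sum L l x i + omit_both_sum_pred L l x i * x (Suc i)"
    and "omit_sum L l x (Suc i) = omit_both_sum L l x i + om L 1 * omit_both_sum_pred L l x i * x i"
proof -
  have fin: "finite S" if "S \<subseteq> {1..L}" for S using that finite_subset by blast
  have iL: "i \<in> {1..L}" "Suc i \<in> {1..L}" using i by auto
  show "omit_sum L l x i = omit_both_sum L l x i + omit_both_sum_pred L l x i * x (Suc i)"
    unfolding omit_sum_def omit_both_sum_def omit_both_sum_pred_def sum_subsets_split[OF iL(2) n_not_Suc_n] sum_distrib_right
    by (intro arg_cong2[where f = "(+)"] sum.cong refl) (auto simp: fin pos_insert_greater)
  have "omit_sum L l x (Suc i) = (\<Sum>S | S \<subseteq> {1..L} \<and> card S = l \<and> Suc i \<notin> S \<and> i \<notin> S. (\<Prod>t\<in>S. x t) * om L 1 ^ pos S i) +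
     (\<Sum>S | S \<subseteq> {1..L} \<and> Suc (card S) = l \<and> Suc i \<notin> S \<and> i \<notin> S. om L 1 * ((\<Prod>t\<in>S. x t) * om L 1 ^ pos S i) * x i)"
    unfolding omit_sum_def sum_subsets_split[OF iL(1) n_not_Suc_n[symmetric]]
    by (intro arg_cong2[where f = "(+)"] sum.cong refl) (auto simp: fin pos_Suc_notin pos_insert_le)
  moreover have "{S. S \<subseteq> {1..L} \<and> P S \<and> i \<notin> S \<and> Suc i \<notin> S} = {S. S \<subseteq> {1..L} \<and> P S \<and> Suc i \<notin> S \<and> i \<notin> S}" for P
    by auto
  ultimately show "omit_sum L l x (Suc i) = omit_both_sum L l x i + om L 1 * omit_both_sum_pred L l x i * x i"
    unfolding omit_both_sum_def omit_both_sum_pred_def sum_distrib_left sum_distrib_right by simp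
qed

section \<open>Simple reflections and the group they generate\<close>

lemma wrefl_apply:
  assumes "i \<in> {1..L-1}" "a \<in> hdual L"
  shows "wrefl L i a = (\<lambda>t. a (swap_adj i t))"
proof -
  have "pair L a (sroot i) = a i - a (Suc i)"
    unfolding pair_commute[of L a] by (rule pair_sroot[OF assms(1)])
  then show ?thesis using assms(2) by (auto simp: wrefl_def sroot_def swap_adj_def)
qed

lemma KK_wrefl:
  assumes "i \<in> {1..L-1}" "a \<in> hdual L"
  shows "KK L l (wrefl L i a) = KK L l a"
  unfolding KK_eq[OF assms(2)] KK_eq[OF wrefl_in_hdual[OF assms]]
  unfolding wrefl_apply[OF assms] by (rule esym_swap_adj[OF assms(1)])

lemma JJ_h1_wrefl:
  assumes L: "L \<ge> 2" and p: "0 < p" "p < 1" and c: "sol_basis L c" and a: "a \<in> hdual L"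
    and K: "\<And>l. l \<in> {1..L-1} \<Longrightarrow> KK L l a \<noteq> 0" and \<sigma>: "\<sigma> \<in> {1..L-1}" and i: "i \<in> {1..L-1}"
  shows "JJ L p (h1 L c \<sigma> (wrefl L i a)) N (wrefl L i a) k = JJ L p (h1 L c \<sigma> a) N a k"
proof -
  interpret swap_setup L N i p k by unfold_locales (use assms in auto)
  define b where "b = wrefl L i a"
  have b: "b \<in> hdual L" unfolding b_def by (rule wrefl_in_hdual[OF i a])
  have bt: "b = (\<lambda>t. a (swap_adj i t))" unfolding b_def by (rule wrefl_apply[OF i a])
  have ab: "b i = a (Suc i)" "b (Suc i) = a i" "\<And>s. s \<noteq> i \<Longrightarrow> s \<noteq> Suc i \<Longrightarrow> b s = a s"
    by (simp_all add: bt swap_adj_def)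
  have iL: "i \<in> {1..L}" "Suc i \<in> {1..L}" using i by auto
  show ?thesis
  proof (cases "\<sigma> = L - 1")
    case True
    define \<eta> where "\<eta> i = om L ((of_nat L - of_nat i) / 2) * qnum L i" for i
    have h: "h1 L c \<sigma> a' = linear_elt L \<eta>" for a'
      using True by (simp add: h1_def iota1_def linear_elt_def \<eta>_def)
    have const: "y_coeff L \<eta> s = om L (- (1 / 2)) * om L (1 / 2)" if "s \<in> {1..L}" for s
      unfolding \<eta>_def by (rule y_coeff_iota[OF L that])
    \<comment> \<open>All coefficients equal one constant, so this constant is \<open>U\<close> and
      \<open>V\<close> is 0.\<close>
    have "JJ L p (linear_elt L \<eta>) N a k = JJ L p (linear_elt L \<eta>) N b k"
      by (rule JJ_swap[OF a b ab, where U = "om L (- (1 / 2)) * om L (1 / 2)" and V = 0])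
         (simp_all add: const[OF iL(1)] const[OF iL(2)] const del: One_nat_def)
    then show ?thesis unfolding h b_def[symmetric] ..
  next
    case False
    define x where "x = (\<lambda>s. om L (a s))"
    have bx: "(\<lambda>s. om L (b s)) = (\<lambda>t. x (swap_adj i t))" by (simp add: bt x_def)
    have csum: "(\<Sum>l=1..L-1. c \<sigma> l) = 0"
      using c \<sigma> False unfolding sol_basis_def by (auto simp: numeral_2_eq_2)
    have e: "esym L l x \<noteq> 0" "esym L l (\<lambda>t. x (swap_adj i t)) \<noteq> 0" if "l \<in> {1..L-1}" for l
      unfolding esym_swap_adj[OF i] using K[OF that] unfolding KK_eq[OF a] x_def by simp_all
    \<comment> \<open>The same \<open>r\<close> serves \<open>a\<close> and its reflection, as
      \<open>esym\<close> is symmetric.\<close>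
    define r where "r l = c \<sigma> l / (qnum L l * esym L l x)" for l
    define \<eta> where "\<eta> i = - h1_coeff L r x i" for i
    define \<theta> where "\<theta> j = - h1_coeff L r (\<lambda>t. x (swap_adj i t)) j" for j
    have ha: "h1 L c \<sigma> a = linear_elt L \<eta>"
      using h1_eq_linear_elt[OF False a, unfolded KK_eq[OF a], folded x_def] unfolding \<eta>_def r_def .
    have hb: "h1 L c \<sigma> b = linear_elt L \<theta>"
      using h1_eq_linear_elt[OF False b, unfolded KK_eq[OF b] bx esym_swap_adj[OF i]] unfolding \<theta>_def r_def .
    define C where "C = om L (- ((of_nat L + 1) / 2))"
    define d where "d l = r l * om L (- ((of_nat l + 1) / 2))" for l
    have l\<eta>: "y_coeff L \<eta> s = C * (\<Sum>l=1..L-1. d l * (om L 1 ^ Suc l * esym L l x - om L 1 * omit_sum L l x s))"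
      if "s \<in> {1..L}" for s
      using y_coeff_h1_coeff[OF L csum e(1) that] unfolding \<eta>_def r_def C_def d_def .
    have l\<theta>: "y_coeff L \<theta> s = C * (\<Sum>l=1..L-1. d l * (om L 1 ^ Suc l * esym L l x - om L 1 * omit_sum L l (\<lambda>t. x (swap_adj i t)) s))"
      if "s \<in> {1..L}" for s
      using y_coeff_h1_coeff[OF L csum e(2) that] unfolding \<theta>_def r_def C_def d_def esym_swap_adj[OF i] .
    \<comment> \<open>Both are built from sums over subsets avoiding \<open>i\<close> and
      \<open>Suc i\<close>, hence common to \<open>a\<close> and its reflection. In
      \<open>UV\<close>, \<open>t\<close> = 1 gives the coefficient at \<open>i\<close> and
      \<open>t\<close> = \<open>om L 1\<close> the one at \<open>Suc i\<close>.\<close>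
    define U where "U = C * (\<Sum>l=1..L-1. d l * (om L 1 ^ Suc l * esym L l x - om L 1 * omit_both_sum L l x i))"
    define V where "V = C * (\<Sum>l=1..L-1. d l * (- om L 1 * omit_both_sum_pred L l x i))"
    have UV: "C * (\<Sum>l=1..L-1. d l * (om L 1 ^ Suc l * esym L l x - om L 1 * (omit_both_sum L l x i + t * omit_both_sum_pred L l x i * z))) = U + t * V * z" for t z
    proof -
      have "(\<Sum>l=1..L-1. d l * (om L 1 ^ Suc l * esym L l x - om L 1 * (omit_both_sum L l x i + t * omit_both_sum_pred L l x i * z))) =
        (\<Sum>l=1..L-1. d l * (om L 1 ^ Suc l * esym L l x - om L 1 * omit_both_sum L l x i)) + t * z * (\<Sum>l=1..L-1. d l * (- om L 1 * omit_both_sum_pred L l x i))"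
        unfolding sum_distrib_left sum.distrib[symmetric]
        by (intro sum.cong refl) (simp add: algebra_simps)
      then show ?thesis unfolding U_def V_def by (simp add: algebra_simps)
    qed
    have "JJ L p (linear_elt L \<eta>) N a k = JJ L p (linear_elt L \<theta>) N b k"
    proof (rule JJ_swap[OF a b ab])
      show "y_coeff L \<theta> s = y_coeff L \<eta> s" if "s \<in> {1..L}" "s \<noteq> i" "s \<noteq> Suc i" for s
        using that by (simp add: l\<eta> l\<theta> omit_sum_swap_adj[OF i])
      have t: "x (swap_adj i i) = x (Suc i)" "x (swap_adj i (Suc i)) = x i" by (simp_all add: swap_adj_def)
      show "y_coeff L \<eta> i = U + V * om L (a (Suc i))"
        unfolding l\<eta>[OF iL(1)] omit_sum_eq[OF i] using UV[of 1] by (simp add: x_def)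
      show "y_coeff L \<eta> (Suc i) = U + om L 1 * V * om L (a i)"
        unfolding l\<eta>[OF iL(2)] omit_sum_eq[OF i] UV by (simp add: x_def)
      show "y_coeff L \<theta> i = U + V * om L (a i)"
        unfolding l\<theta>[OF iL(1)] omit_sum_eq[OF i] omit_both_sum_swap_adj t using UV[of 1] by (simp add: x_def)
      show "y_coeff L \<theta> (Suc i) = U + om L 1 * V * om L (a (Suc i))"
        unfolding l\<theta>[OF iL(2)] omit_sum_eq[OF i] omit_both_sum_swap_adj t UV by (simp add: x_def)
    qed
    then show ?thesis unfolding ha hb b_def[symmetric] ..
  qed
qed

theorem mainTheorem8:
  fixes L N :: nat and p :: real and c :: "nat \<Rightarrow> nat \<Rightarrow> complex"
    and a :: "nat \<Rightarrow> complex" and k :: "nat \<Rightarrow> nat" and \<sigma> :: nat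
    and w :: "(nat \<Rightarrow> complex) \<Rightarrow> (nat \<Rightarrow> complex)"
  assumes "L \<ge> 2"
    and "0 < p" "p < 1" "p \<notin> \<rat>"
    and "sol_basis L c"
    and "a \<in> hdual L"
    and "\<forall>l\<in>{1..L-1}. KK L l a \<noteq> 0"
    and "\<sigma> \<in> {1..L-1}"
    and "w \<in> weyl L"
    and "\<forall>n\<in>{1..N}. k n \<in> {1..L-1}"
  shows "JJ L p (h1 L c \<sigma> a) N a k = JJ L p (h1 L c \<sigma> (w a)) N (w a) k"
proof -
  let ?G = "BijGroup (hdual L)"
  interpret G: group ?G by (rule group_BijGroup)
  \<comment> \<open>By \<open>KK_wrefl\<close> this set is stable under the reflections. The
    induction claims invariance at every point of \<open>D\<close>, because in a product the outer
    factor is applied at the image under the inner one.\<close>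
  define D where "D = {a \<in> hdual L. \<forall>l\<in>{1..L-1}. KK L l a \<noteq> 0}"
  define F where "F b = JJ L p (h1 L c \<sigma> b) N b k" for b
  have r: "wrefl L i b \<in> D \<and> F (wrefl L i b) = F b" if "i \<in> {1..L-1}" "b \<in> D" for i b
    using that assms JJ_h1_wrefl[of L p c b \<sigma> i N k]
    by (auto simp: D_def F_def wrefl_in_hdual KK_wrefl)
  \<comment> \<open>\<open>generate\<close> also admits inverses of the generators; here these are
    the reflections themselves.\<close>
  have wrefl_inv: "inv\<^bsub>?G\<^esub> (wrefl L i) = wrefl L i" if i: "i \<in> {1..L-1}" for i
  proof (rule G.inv_equality)
    show g: "wrefl L i \<in> carrier ?G" "wrefl L i \<in> carrier ?G"
      using i by (rule wrefl_in_Bij)+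
    then show "wrefl L i \<otimes>\<^bsub>?G\<^esub> wrefl L i = \<one>\<^bsub>?G\<^esub>"
      by (auto simp: BijGroup_def compose_def wrefl_wrefl[OF i] fun_eq_iff)
  qed
  \<comment> \<open>Membership in the carrier is carried along because the product of
    \<open>BijGroup\<close> is a composition restricted to bijections of
    \<open>hdual L\<close>.\<close>
  have "w \<in> carrier ?G \<and> (\<forall>b\<in>D. w b \<in> D \<and> F (w b) = F b)"
    using \<open>w \<in> weyl L\<close> unfolding weyl_def
  proof (induction rule: generate.induct)
    case one
    have "\<one>\<^bsub>?G\<^esub> b = b" if "b \<in> D" for b
      using that by (simp add: BijGroup_def D_def)
    then show ?case by simp
  next
    case (incl h)
    then show ?case using r wrefl_in_Bij by auto
  next
    case (inv h)
    then show ?case using r wrefl_in_Bij wrefl_inv by auto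
  next
    case (eng h1 h2)
    have "(h1 \<otimes>\<^bsub>?G\<^esub> h2) b = h1 (h2 b)" if "b \<in> D" for b
      using eng that by (simp add: BijGroup_def compose_def D_def)
    then show ?case using eng by simp
  qed
  moreover have "a \<in> D" using assms by (simp add: D_def)
  ultimately show ?thesis unfolding F_def by simp
qed

end
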